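(* Let $\mathcal{X}$ be a finite non-empty set and let $\overline{T}\colon\mathbb{R}^{\mathcal{X}}\to\mathbb{R}^{\mathcal{X}}$ be a finitely generated upper transition operator. Let $\mathcal{X}_{\mathrm{m},1},\dots,\mathcal{X}_{\mathrm{m},M}$ be its maximal communication classes, and let $\mathcal{X}_{\mathrm{t}\triangledown}=\mathcal{X}_{\mathrm{t}\triangledown}^1$, $d$, $\mathcal{X}_{\mathrm{t}\triangledown}^{\ell}$ and $\mathcal{X}_{\mathrm{m},1}^{\ell},\dots,\mathcal{X}_{\mathrm{m},M_\ell}^{\ell}$ be as in the repeated decomposition of $\mathcal{X}$ described in the context. Then the following are equivalent: (i) $\overline{T}$ is convergent; (ii) the maximal communication classes $\mathcal{X}_{\mathrm{m},1},\dots,\mathcal{X}_{\mathrm{m},M}$ are regular (for $\overline{T}$) and the restricted operator $\overline{T}_{\mathcal{X}_{\mathrm{t}\triangledown}}$ is convergent (the latter requirement being void if $\mathcal{X}_{\mathrm{t}\triangledown}=\emptyset$); (iii) for all $\ell\in\{1,\dots,d\}$, the maximal communication classes $\mathcal{X}_{\mathrm{m},1}^{\ell},\dots,\mathcal{X}_{\mathrm{m},M_\ell}^{\ell}$ of $\overline{T}_{\mathcal{X}_{\mathrm{t}\triangledown}^{\ell-1}}$ are regular for $\overline{T}_{\mathcal{X}_{\mathrm{t}\triangledown}^{\ell-1}}$.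
   Context: The following definitions apply to any finite non-empty state space $\mathcal{Y}$ (in particular to $\mathcal{X}$ and its non-empty subsets). $\mathbb{N}=\{1,2,\dots\}$; order on functions is pointwise; constants are identified with constant functions; $\mathbb{1}_A$ is the indicator of $A$ and $\mathbb{1}_y=\mathbb{1}_{\{y\}}$. Upper transition operator on $\mathcal{Y}$: a map $\overline{T}\colon\mathbb{R}^{\mathcal{Y}}\to\mathbb{R}^{\mathcal{Y}}$ with $\overline{T}(f+g)\le\overline{T}f+\overline{T}g$, $\overline{T}(\lambda f)=\lambda\overline{T}f$ for real $\lambda\ge0$, and $\overline{T}f\le\max f$. Its conjugate lower transition operator is $\underline{T}f:=-\overline{T}(-f)$. $\overline{T}$ is convergent if $(\overline{T}^nf)_{n\in\mathbb{N}}$ converges for all $f\in\mathbb{R}^{\mathcal{Y}}$. $\overline{T}$ is finitely generated if there are finite non-empty sets $\mathcal{P}^x$ ($x\in\mathcal{Y}$) of probability mass functions on $\mathcal{Y}$ with $\overline{T}f(x)=\max\{\sum_yp(y)f(y)\colon p\in\mathcal{P}^x\}$ for all $f\in\mathbb{R}^{\mathcal{Y}}$ and $x\in\mathcal{Y}$. Graph notions: the upper accessibility graph of $\overline{T}$ has node set $\mathcal{Y}$ and a directed edge from $x$ to $y$ iff $\overline{T}\mathbb{1}_y(x)>0$. $y$ is accessible from $x$ if $y=x$ or there is a directed path from $x$ to $y$. Two states communicate if each is accessible from the other; the equivalence classes are the communication classes. A communication class is maximal if no state outside it is accessible from a state in it. A maximal communication class $C$ is regular (for $\overline{T}$) if the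 greatest common divisor of the lengths of the closed directed paths staying in $C$ is $1$; equivalently, if there is $N\in\mathbb{N}$ with $\overline{T}^n\mathbb{1}_y(x)>0$ for all $n\ge N$ and $x,y\in C$. A non-empty set $C\subseteq\mathcal{Y}$ is lower reachable from $x$ if $\underline{T}^n\mathbb{1}_C(x)>0$ for some $n\in\mathbb{N}$. Restriction: for $x\in\mathcal{Y}$, the credal set $\mathcal{Q}^x$ is the set of probability mass functions $p$ on $\mathcal{Y}$ with $\sum_y p(y)f(y)\le\overline{T}f(x)$ for all $f\in\mathbb{R}^{\mathcal{Y}}$. For non-empty $C\subseteq\mathcal{Y}$ and $x\in C$, $\mathcal{Q}^x_C:=\{p|_C\colon p\in\mathcal{Q}^x,\ p(y)=0\text{ for all }y\in\mathcal{Y}\setminus C\}$. If $\mathcal{Q}_C^x\neq\emptyset$ for all $x\in C$, the restricted operator $\overline{T}_C\colon\mathbb{R}^C\to\mathbb{R}^C$ is well defined: $\overline{T}_Cg(x):=\max\{\sum_{y\in C}q(y)g(y)\colon q\in\mathcal{Q}^x_C\}$; it is an upper transition operator on $C$. Repeated decomposition: set $\mathcal{X}_{\mathrm{t}\triangledown}^0:=\mathcal{X}$ and $\overline{T}_{\mathcal{X}_{\mathrm{t}\triangledown}^0}:=\overline{T}$. For $\ell=1,2,\dots$, as long as $\mathcal{X}_{\mathrm{t}\triangledown}^{\ell-1}\neq\emptyset$: let $\mathcal{X}_{\mathrm{m},1}^\ell,\dots,\mathcal{X}_{\mathrm{m},M_\ell}^\ell$ be the maximal communication classes of the upper transition operator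 $\overline{T}_{\mathcal{X}_{\mathrm{t}\triangledown}^{\ell-1}}$ on state space $\mathcal{X}_{\mathrm{t}\triangledown}^{\ell-1}$, let $\mathcal{X}_{\mathrm{m}}^\ell$ be their union, let $\mathcal{X}_{\mathrm{t}\blacktriangledown}^\ell$ (respectively $\mathcal{X}_{\mathrm{t}\triangledown}^\ell$) be the set of states in $\mathcal{X}_{\mathrm{t}\triangledown}^{\ell-1}\setminus\mathcal{X}_{\mathrm{m}}^\ell$ from which $\mathcal{X}_{\mathrm{m}}^\ell$ is (respectively is not) lower reachable with respect to $\overline{T}_{\mathcal{X}_{\mathrm{t}\triangledown}^{\ell-1}}$; if $\mathcal{X}_{\mathrm{t}\triangledown}^\ell\ne\emptyset$, restrict $\overline{T}_{\mathcal{X}_{\mathrm{t}\triangledown}^{\ell-1}}$ to $\mathcal{X}_{\mathrm{t}\triangledown}^\ell$ (this restriction is always well defined and equals $\overline{T}_{\mathcal{X}_{\mathrm{t}\triangledown}^{\ell}}$, the direct restriction of $\overline{T}$) and continue. $d$ is the first $\ell\ge1$ with $\mathcal{X}_{\mathrm{t}\triangledown}^\ell=\emptyset$. For $\ell=1$ the superscript is dropped: $\mathcal{X}_{\mathrm{m},k}=\mathcal{X}_{\mathrm{m},k}^1$, $M=M_1$, $\mathcal{X}_{\mathrm{t}\triangledown}=\mathcal{X}_{\mathrm{t}\triangledown}^1$. *)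

theory Defs
  imports "HOL-Probability.Probability_Mass_Function"
begin

(* A state space is a finite set Y of elements of some type 'a.  An element of R^Y is represented
   by any total function of type 'a => real that has the given values on Y, so equalities and
   inequalities in R^Y are stated at the points of Y only.  The first conjunct below says that T
   induces a map from R^Y to R^Y.  It also makes the values of iterates of T on Y independent of
   the representatives chosen. *)

definition upper_transition_operator ::
  "'a set \<Rightarrow> (('a \<Rightarrow> real) \<Rightarrow> 'a \<Rightarrow> real) \<Rightarrow> bool" where
  "upper_transition_operator Y T \<longleftrightarrow>
     (\<forall>f g. (\<forall>y\<in>Y. f y = g y) \<longrightarrow> (\<forall>x\<in>Y. T f x = T g x)) \<and>
     (\<forall>f g. \<forall>x\<in>Y. T (\<lambda>y. f y + g y) x \<le> T f x + T g x) \<and>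
     (\<forall>f. \<forall>c\<ge>0. \<forall>x\<in>Y. T (\<lambda>y. c * f y) x = c * T f x) \<and>
     (\<forall>f. \<forall>x\<in>Y. T f x \<le> Max (f ` Y))"

definition lower_operator ::
  "(('a \<Rightarrow> real) \<Rightarrow> 'a \<Rightarrow> real) \<Rightarrow> ('a \<Rightarrow> real) \<Rightarrow> 'a \<Rightarrow> real" where
  "lower_operator T = (\<lambda>f x. - T (\<lambda>y. - f y) x)"

(* Convergence in R^Y is pointwise convergence, as Y is finite. *)
definition convergent_operator ::
  "'a set \<Rightarrow> (('a \<Rightarrow> real) \<Rightarrow> 'a \<Rightarrow> real) \<Rightarrow> bool" where
  "convergent_operator Y T \<longleftrightarrow> (\<forall>f. \<forall>x\<in>Y. convergent (\<lambda>n. (T ^^ n) f x))"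

(* The probability mass functions on Y are the elements p of 'a pmf with support in Y. *)
definition finitely_generated ::
  "'a set \<Rightarrow> (('a \<Rightarrow> real) \<Rightarrow> 'a \<Rightarrow> real) \<Rightarrow> bool" where
  "finitely_generated Y T \<longleftrightarrow>
     (\<exists>P :: 'a \<Rightarrow> 'a pmf set.
        (\<forall>x\<in>Y. finite (P x) \<and> P x \<noteq> {} \<and> (\<forall>p\<in>P x. set_pmf p \<subseteq> Y)) \<and>
        (\<forall>f. \<forall>x\<in>Y. T f x = Max ((\<lambda>p. \<Sum>y\<in>Y. pmf p y * f y) ` P x)))"

definition accessibility_graph ::
  "'a set \<Rightarrow> (('a \<Rightarrow> real) \<Rightarrow> 'a \<Rightarrow> real) \<Rightarrow> ('a \<times> 'a) set" where
  "accessibility_graph Y T = {(x, y). x \<in> Y \<and> y \<in> Y \<and> T (indicator {y}) x > 0}"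

definition accessible ::
  "'a set \<Rightarrow> (('a \<Rightarrow> real) \<Rightarrow> 'a \<Rightarrow> real) \<Rightarrow> 'a \<Rightarrow> 'a \<Rightarrow> bool" where
  "accessible Y T x y \<longleftrightarrow> (x, y) \<in> (accessibility_graph Y T)\<^sup>*"

definition communication_classes ::
  "'a set \<Rightarrow> (('a \<Rightarrow> real) \<Rightarrow> 'a \<Rightarrow> real) \<Rightarrow> 'a set set" where
  "communication_classes Y T =
     Y // {(x, y). x \<in> Y \<and> y \<in> Y \<and> accessible Y T x y \<and> accessible Y T y x}"

definition maximal_classes ::
  "'a set \<Rightarrow> (('a \<Rightarrow> real) \<Rightarrow> 'a \<Rightarrow> real) \<Rightarrow> 'a set set" where
  "maximal_classes Y T =
     {C \<in> communication_classes Y T. \<forall>x\<in>C. \<forall>y\<in>Y - C. \<not> accessible Y T x y}"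

definition regular_class ::
  "'a set \<Rightarrow> (('a \<Rightarrow> real) \<Rightarrow> 'a \<Rightarrow> real) \<Rightarrow> 'a set \<Rightarrow> bool" where
  "regular_class Y T C \<longleftrightarrow>
     Gcd {n::nat. n \<ge> 1 \<and> (\<exists>x\<in>C. (x, x) \<in> (accessibility_graph Y T \<inter> C \<times> C) ^^ n)} = 1"

definition lower_reachable ::
  "(('a \<Rightarrow> real) \<Rightarrow> 'a \<Rightarrow> real) \<Rightarrow> 'a set \<Rightarrow> 'a \<Rightarrow> bool" where
  "lower_reachable T C x \<longleftrightarrow> (\<exists>n\<ge>1. (lower_operator T ^^ n) (indicator C) x > 0)"

definition credal_set ::
  "'a set \<Rightarrow> (('a \<Rightarrow> real) \<Rightarrow> 'a \<Rightarrow> real) \<Rightarrow> 'a \<Rightarrow> 'a pmf set" where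
  "credal_set Y T x = {p. set_pmf p \<subseteq> Y \<and> (\<forall>f. (\<Sum>y\<in>Y. pmf p y * f y) \<le> T f x)}"

(* The restriction of p to C needs no separate name: if p vanishes on Y - C, then the same
   element of 'a pmf also represents a probability mass function on C. *)
definition restricted_credal_set ::
  "'a set \<Rightarrow> (('a \<Rightarrow> real) \<Rightarrow> 'a \<Rightarrow> real) \<Rightarrow> 'a set \<Rightarrow> 'a \<Rightarrow> 'a pmf set" where
  "restricted_credal_set Y T C x = {p \<in> credal_set Y T x. \<forall>y\<in>Y - C. pmf p y = 0}"

(* The supremum is a maximum whenever x is in C and restricted_credal_set Y T C x is nonempty,
   because that set is compact. *)
definition restricted_operator ::
  "'a set \<Rightarrow> (('a \<Rightarrow> real) \<Rightarrow> 'a \<Rightarrow> real) \<Rightarrow> 'a set \<Rightarrow> ('a \<Rightarrow> real) \<Rightarrow> 'a \<Rightarrow> real" where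
  "restricted_operator Y T C =
     (\<lambda>g x. SUP q\<in>restricted_credal_set Y T C x. \<Sum>y\<in>C. pmf q y * g y)"

definition non_absorbed ::
  "'a set \<Rightarrow> (('a \<Rightarrow> real) \<Rightarrow> 'a \<Rightarrow> real) \<Rightarrow> 'a set" where
  "non_absorbed Y T =
     {x \<in> Y - \<Union>(maximal_classes Y T). \<not> lower_reachable T (\<Union>(maximal_classes Y T)) x}"

(* Stage l of the repeated decomposition: the remaining state space together with its operator.
   Only the stages up to the first empty state space are meaningful. *)
primrec decomposition ::
  "'a set \<Rightarrow> (('a \<Rightarrow> real) \<Rightarrow> 'a \<Rightarrow> real) \<Rightarrow> nat \<Rightarrow>
     'a set \<times> (('a \<Rightarrow> real) \<Rightarrow> 'a \<Rightarrow> real)" where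
  "decomposition X T 0 = (X, T)"
| "decomposition X T (Suc l) =
     (let (Y, S) = decomposition X T l; Z = non_absorbed Y S
      in (Z, restricted_operator Y S Z))"

definition stage_space ::
  "'a set \<Rightarrow> (('a \<Rightarrow> real) \<Rightarrow> 'a \<Rightarrow> real) \<Rightarrow> nat \<Rightarrow> 'a set" where
  "stage_space X T l = fst (decomposition X T l)"

definition stage_operator ::
  "'a set \<Rightarrow> (('a \<Rightarrow> real) \<Rightarrow> 'a \<Rightarrow> real) \<Rightarrow> nat \<Rightarrow> ('a \<Rightarrow> real) \<Rightarrow> 'a \<Rightarrow> real" where
  "stage_operator X T l = snd (decomposition X T l)"

definition decomposition_depth ::
  "'a set \<Rightarrow> (('a \<Rightarrow> real) \<Rightarrow> 'a \<Rightarrow> real) \<Rightarrow> nat" where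
  "decomposition_depth X T = (LEAST l. l \<ge> 1 \<and> stage_space X T l = {})"

end

theory Submission
  imports Defs
begin

text \<open>
  Write \<open>Z\<close> for \<open>non_absorbed Y T\<close>. A state belongs to \<open>Z\<close> iff one of its generators is supported
  in \<open>Z\<close>, and the restricted operator is the maximum over these generators.

  If \<open>T\<close> is convergent, then so is its restriction \<open>S\<close>: let \<open>w\<close> be the image
  under \<open>T ^^ N\<close> of minus the indicator of the maximal classes. Then \<open>T w \<le> w \<le> 0\<close>, and for large \<open>N\<close>
  the zeros of \<open>w\<close> are exactly the points of \<open>Z\<close>.
  Extending \<open>g\<close> by \<open>G + K * w\<close> outside \<open>Z\<close> with \<open>K\<close> large makes leaving \<open>Z\<close> never worthwhile, so the
  iterates of \<open>T\<close> and \<open>S\<close> agree on \<open>Z\<close>. A maximal class of period greater than one has a cyclic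
  subclass whose indicator oscillates.

  Conversely, regularity makes the oscillation on a maximal class contract. For the other states,
  let \<open>v\<close> be a limit point of \<open>(T ^^ n) f\<close> and \<open>V n = (T ^^ n) v\<close>. The quantity
  \<open>max (V n - V (n + 1))\<close> has the same value \<open>c\<close> for all \<open>n\<close>. If \<open>c > 0\<close>, then the sets \<open>A n\<close> of
  maximisers avoid the maximal classes, and an optimal generator at a point of \<open>A (n + 1)\<close> is
  supported in \<open>A n\<close>. Hence \<open>A n\<close> lies in \<open>Z\<close> for \<open>n \<ge> N\<close>, and \<open>V (n + N)\<close> equals \<open>(S ^^ n) (V N)\<close>
  on \<open>A (n + N)\<close> while \<open>V (n + 1 + N)\<close> is at least \<open>(S ^^ (n + 1)) (V N)\<close> on \<open>Z\<close>, so that consecutive iterates of \<open>S\<close> differ by at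
  least \<open>c\<close>, against convergence. So \<open>c \<le> 0\<close>, the sequence \<open>V\<close> increases to a limit, and by
  nonexpansiveness \<open>(T ^^ n) f\<close> is a Cauchy sequence.
\<close>

section \<open>Primitive relations and limits on finite sets\<close>

text \<open>The least positive difference \<open>e\<close> of two elements divides every element
  \<open>s\<close>, because \<open>s mod e\<close> is again such a difference. Hence
  \<open>e = 1\<close>, and two consecutive elements \<open>b\<close>, \<open>b + 1\<close> generate
  all numbers from \<open>b * b\<close> on.\<close>

lemma additive_gcd_1_cofinite:
  fixes S :: "nat set"
  assumes zero: "0 \<in> S" and add: "\<And>a b. a \<in> S \<Longrightarrow> b \<in> S \<Longrightarrow> a + b \<in> S" and gcd: "Gcd S = 1"
  shows "\<exists>N. \<forall>n\<ge>N. n \<in> S"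
proof -
  have mult: "k * a \<in> S" if "a \<in> S" for k a
    using that by (induction k) (auto simp: zero add)
  define Q where "Q k \<longleftrightarrow> k > 0 \<and> (\<exists>b\<in>S. b + k \<in> S)" for k
  define e where "e = (LEAST k. Q k)"
  have "\<exists>s\<in>S. s \<noteq> 0"
    using gcd by (metis Gcd_0_iff subsetI singleton_iff zero_neq_one)
  then obtain s where "s \<in> S" "s \<noteq> 0" by blast
  then have "Q s" using zero unfolding Q_def by (metis add_0 neq0_conv)
  then have "Q e" unfolding e_def by (rule LeastI)
  then obtain b where b: "b \<in> S" "b + e \<in> S" and "e > 0"
    by (auto simp: Q_def)
  have "e dvd s" if s: "s \<in> S" for s
  proof (rule ccontr)
    assume "\<not> e dvd s"
    then have r: "s mod e > 0" by (simp add: dvd_eq_mod_eq_0)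
    define q where "q = s div e"
    have "q * (b + e) + s mod e = s + q * b"
      unfolding q_def using div_mult_mod_eq[of s e] by (simp add: algebra_simps)
    moreover have "s + q * b \<in> S" "q * (b + e) \<in> S"
      using b s by (auto intro: add mult)
    ultimately have "Q (s mod e)"
      using r unfolding Q_def by metis
    then have "e \<le> s mod e" unfolding e_def by (rule Least_le)
    then show False using mod_less_divisor[OF \<open>e > 0\<close>, of s] by linarith
  qed
  then have "e dvd 1" using gcd by (metis Gcd_greatest)
  then have b1: "b + 1 \<in> S" using b by simp
  have "n \<in> S" if n: "n \<ge> b * b" for n
  proof (cases "b = 0")
    case True
    then show ?thesis using mult[OF b1, of n] by simp
  next
    case False
    define q r where "q = n div b" and "r = n mod b"
    have "r < b" using False by (simp add: r_def)
    moreover have "b \<le> q" using n False by (simp add: q_def less_eq_div_iff_mult_less_eq)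
    ultimately have "n = (q - r) * b + r * (b + 1)"
      using div_mult_mod_eq[of n b] unfolding q_def[symmetric] r_def[symmetric]
      by (simp add: algebra_simps diff_mult_distrib2)
    then show ?thesis using add[OF mult[OF b(1)] mult[OF b1]] by metis
  qed
  then show ?thesis by blast
qed

lemma relpow_mono:
  fixes R S :: "('a \<times> 'a) set"
  assumes "(x, y) \<in> R ^^ n" "R \<subseteq> S"
  shows "(x, y) \<in> S ^^ n"
  using assms(1)
proof (induction n arbitrary: y)
  case (Suc n)
  then show ?case using \<open>R \<subseteq> S\<close> by (auto elim!: relpow_Suc_E intro: relpow_Suc_I)
qed simp

text \<open>Splicing a closed walk at \<open>x\<close> into a round trip from a fixed
  \<open>x0\<close> shows that the closed walks at \<open>x0\<close> alone have lengths with gcd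
  1.\<close>

lemma primitive_relation:
  assumes "finite C" and "C \<noteq> {}"
    and conn: "\<And>x y. x \<in> C \<Longrightarrow> y \<in> C \<Longrightarrow> (x, y) \<in> R\<^sup>*"
    and gcd: "Gcd {n::nat. n \<ge> 1 \<and> (\<exists>x\<in>C. (x, x) \<in> R ^^ n)} = 1"
  shows "\<exists>N. \<forall>x\<in>C. \<forall>y\<in>C. (x, y) \<in> R ^^ N"
proof -
  obtain x0 where x0: "x0 \<in> C" using \<open>C \<noteq> {}\<close> by blast
  have "\<forall>x\<in>C. \<exists>n. (x, x0) \<in> R ^^ n" "\<forall>x\<in>C. \<exists>n. (x0, x) \<in> R ^^ n"
    using conn x0 by (meson rtrancl_imp_relpow)+
  then obtain a b where a: "\<And>x. x \<in> C \<Longrightarrow> (x, x0) \<in> R ^^ a x"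
    and b: "\<And>x. x \<in> C \<Longrightarrow> (x0, x) \<in> R ^^ b x" by metis
  have trans: "(x, z) \<in> R ^^ (m + n)" if "(x, y) \<in> R ^^ m" "(y, z) \<in> R ^^ n" for x y z m n
    using that by (auto simp: relpow_add)
  define S where "S = {n. (x0, x0) \<in> R ^^ n}"
  have "Gcd S dvd n" if "x \<in> C" "(x, x) \<in> R ^^ n" for x n
  proof -
    have "b x + a x \<in> S" "b x + n + a x \<in> S"
      using trans[OF b a] trans[OF trans[OF b] a] that by (auto simp: S_def)
    then have "Gcd S dvd b x + a x" "Gcd S dvd n + (b x + a x)"
      by (auto simp: add_ac)
    then show ?thesis using dvd_add_left_iff by blast
  qed
  then have "Gcd S dvd Gcd {n::nat. n \<ge> 1 \<and> (\<exists>x\<in>C. (x, x) \<in> R ^^ n)}"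
    by (intro Gcd_greatest) auto
  then have "Gcd S = 1" using gcd by (metis dvd_1_iff_1 One_nat_def)
  then have "\<exists>N. \<forall>n\<ge>N. n \<in> S"
    by (intro additive_gcd_1_cofinite) (auto simp: S_def trans)
  then obtain N where N: "\<And>n. n \<ge> N \<Longrightarrow> (x0, x0) \<in> R ^^ n" by (auto simp: S_def)
  \<comment> \<open>\<open>K\<close> bounds the length \<open>a x + b y\<close> of a walk through
    \<open>x0\<close>, so the missing length is at least \<open>N\<close> and can be filled by a
    loop at \<open>x0\<close>.\<close>
  define K where "K = Max (a ` C) + Max (b ` C)"
  have "(x, y) \<in> R ^^ (N + K)" if "x \<in> C" "y \<in> C" for x y
  proof -
    have "a x \<le> Max (a ` C)" "b y \<le> Max (b ` C)" using that \<open>finite C\<close> by auto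
    then have K: "a x + b y \<le> K" by (simp add: K_def)
    have "(x, y) \<in> R ^^ (a x + (N + K - (a x + b y)) + b y)"
      using that K by (intro trans[OF trans[OF a N] b]) auto
    moreover have "a x + (N + K - (a x + b y)) + b y = N + K" using K by simp
    ultimately show ?thesis by metis
  qed
  then show ?thesis by blast
qed

text \<open>Bolzano-Weierstrass, one coordinate at a time: each new coordinate refines the
  subsequence found so far.\<close>

lemma finite_convergent_subsequence:
  fixes u :: "nat \<Rightarrow> 'a \<Rightarrow> real"
  assumes "finite Y" and "\<And>n y. y \<in> Y \<Longrightarrow> \<bar>u n y\<bar> \<le> K"
  shows "\<exists>r v. strict_mono (r :: nat \<Rightarrow> nat) \<and> (\<forall>y\<in>Y. (\<lambda>k. u (r k) y) \<longlonglongrightarrow> v y)"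
  using assms
proof (induction Y rule: finite_induct)
  case empty
  then show ?case using strict_mono_id by (metis empty_iff)
next
  case (insert z Y)
  then obtain r v where r: "strict_mono r" and v: "\<forall>y\<in>Y. (\<lambda>k. u (r k) y) \<longlonglongrightarrow> v y"
    by fastforce
  have "bounded (range (\<lambda>k. u (r k) z))"
    using insert.prems by (auto simp: bounded_iff)
  then obtain l s where s: "strict_mono s" and l: "((\<lambda>k. u (r k) z) \<circ> s) \<longlonglongrightarrow> l"
    using bounded_imp_convergent_subsequence by blast
  have "(\<lambda>k. u ((r \<circ> s) k) y) \<longlonglongrightarrow> (v(z := l)) y" if "y \<in> insert z Y" for y
    using that l v LIMSEQ_subseq_LIMSEQ[OF _ s, of "\<lambda>k. u (r k) y"]
    by (cases "y = z") (auto simp: o_def)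
  then show ?case using strict_mono_o[OF r s] by blast
qed

lemma tendsto_Max_image:
  fixes u :: "nat \<Rightarrow> 'a \<Rightarrow> real"
  assumes "finite Y" "Y \<noteq> {}" and "\<And>y. y \<in> Y \<Longrightarrow> (\<lambda>k. u k y) \<longlonglongrightarrow> v y"
  shows "(\<lambda>k. Max (u k ` Y)) \<longlonglongrightarrow> Max (v ` Y)"
  using assms
  by (induction Y rule: finite_ne_induct) (auto intro!: tendsto_max)

section \<open>Finitely generated operators\<close>

text \<open>Summing over the support instead of the state space lets the same generator serve an
  operator and its restriction.\<close>

definition mean :: "'a pmf \<Rightarrow> ('a \<Rightarrow> real) \<Rightarrow> real" where
  "mean p f = (\<Sum>y\<in>set_pmf p. pmf p y * f y)"

lemma mean_eq_sum:
  assumes "finite Y" "set_pmf p \<subseteq> Y"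
  shows "(\<Sum>y\<in>Y. pmf p y * f y) = mean p f"
  unfolding mean_def using assms by (intro sum.mono_neutral_right) (auto simp: set_pmf_iff)

lemma mean_mono:
  assumes "\<And>y. y \<in> set_pmf p \<Longrightarrow> f y \<le> g y"
  shows "mean p f \<le> mean p g"
  unfolding mean_def using assms by (intro sum_mono mult_left_mono) auto

lemma mean_cong:
  assumes "\<And>y. y \<in> set_pmf p \<Longrightarrow> f y = g y"
  shows "mean p f = mean p g"
  unfolding mean_def using assms by (intro sum.cong) auto

lemma mean_strict_mono:
  assumes "finite (set_pmf p)" "\<And>y. y \<in> set_pmf p \<Longrightarrow> f y \<le> g y"
    and "z \<in> set_pmf p" "f z < g z"
  shows "mean p f < mean p g"
  unfolding mean_def using assms
  by (intro sum_strict_mono_ex1) (auto intro!: mult_left_mono mult_strict_left_mono simp: pmf_positive)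

lemma mean_const:
  assumes "finite (set_pmf p)"
  shows "mean p (\<lambda>y. c) = c"
  using sum_pmf_eq_1[OF assms order_refl] by (simp add: mean_def flip: sum_distrib_right)

lemma mean_affine:
  assumes "finite (set_pmf p)"
  shows "mean p (\<lambda>y. a + b * f y) = a + b * mean p f"
proof -
  have "mean p (\<lambda>y. a + b * f y) = mean p (\<lambda>y. a) + b * mean p f"
    by (simp add: mean_def algebra_simps sum.distrib sum_distrib_left)
  then show ?thesis using mean_const[OF assms] by simp
qed

lemma mean_diff: "mean p (\<lambda>y. f y - g y) = mean p f - mean p g"
  by (simp add: mean_def algebra_simps sum_subtractf)

lemma mean_le_const:
  assumes "finite (set_pmf p)" "\<And>y. y \<in> set_pmf p \<Longrightarrow> f y \<le> c"
  shows "mean p f \<le> c"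
  using mean_mono[of p f "\<lambda>_. c"] assms mean_const[of p c] by simp

lemma mean_ge_const:
  assumes "finite (set_pmf p)" "\<And>y. y \<in> set_pmf p \<Longrightarrow> c \<le> f y"
  shows "c \<le> mean p f"
  using mean_mono[of p "\<lambda>_. c" f] assms mean_const[of p c] by simp

lemma mean_less_const:
  assumes "finite (set_pmf p)" "\<And>y. y \<in> set_pmf p \<Longrightarrow> f y \<le> c"
    and "z \<in> set_pmf p" "f z < c"
  shows "mean p f < c"
  using mean_strict_mono[of p f "\<lambda>_. c" z] assms mean_const[of p c] by simp

lemma mean_indicator_singleton:
  assumes "finite (set_pmf p)"
  shows "mean p (indicator {y}) = pmf p y"
proof -
  have "mean p (indicator {y}) = (\<Sum>z\<in>set_pmf p. if z = y then pmf p z else 0)"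
    unfolding mean_def by (intro sum.cong) (auto simp: indicator_def)
  then show ?thesis using assms by (simp add: set_pmf_iff)
qed

text \<open>The generating sets are fixed as data, so that the restriction to
  \<open>non_absorbed Y T\<close> becomes another instance. \<open>Y\<close> may be empty, as at the
  end of the decomposition.\<close>

locale generated_operator =
  fixes Y :: "'a set" and T :: "('a \<Rightarrow> real) \<Rightarrow> 'a \<Rightarrow> real" and P :: "'a \<Rightarrow> 'a pmf set"
  assumes finite_space: "finite Y"
    and finite_P: "x \<in> Y \<Longrightarrow> finite (P x)"
    and P_nonempty: "x \<in> Y \<Longrightarrow> P x \<noteq> {}"
    and P_space: "x \<in> Y \<Longrightarrow> p \<in> P x \<Longrightarrow> set_pmf p \<subseteq> Y"
    and T_Max: "x \<in> Y \<Longrightarrow> T f x = Max ((\<lambda>p. mean p f) ` P x)"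

lemma finitely_generated_iff:
  assumes "finite Y"
  shows "finitely_generated Y T \<longleftrightarrow> (\<exists>P. generated_operator Y T P)"
proof
  assume "finitely_generated Y T"
  then obtain P where P: "\<forall>x\<in>Y. finite (P x) \<and> P x \<noteq> {} \<and> (\<forall>p\<in>P x. set_pmf p \<subseteq> Y)"
    and T: "\<forall>f. \<forall>x\<in>Y. T f x = Max ((\<lambda>p. \<Sum>y\<in>Y. pmf p y * f y) ` P x)"
    unfolding finitely_generated_def by auto
  have "generated_operator Y T P"
  proof
    fix x f assume x: "x \<in> Y"
    have "(\<lambda>p. \<Sum>y\<in>Y. pmf p y * f y) ` P x = (\<lambda>p. mean p f) ` P x"
      using P x assms by (intro image_cong refl mean_eq_sum) auto
    then show "T f x = Max ((\<lambda>p. mean p f) ` P x)" using T x by simp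
  qed (use P assms in auto)
  then show "\<exists>P. generated_operator Y T P" by blast
next
  assume "\<exists>P. generated_operator Y T P"
  then obtain P where "generated_operator Y T P" by blast
  then interpret generated_operator Y T P .
  have "T f x = Max ((\<lambda>p. \<Sum>y\<in>Y. pmf p y * f y) ` P x)" if x: "x \<in> Y" for f x
  proof -
    have "(\<lambda>p. \<Sum>y\<in>Y. pmf p y * f y) ` P x = (\<lambda>p. mean p f) ` P x"
      using P_space x assms by (intro image_cong refl mean_eq_sum) auto
    then show ?thesis using T_Max x by simp
  qed
  then show "finitely_generated Y T"
    unfolding finitely_generated_def using finite_P P_nonempty P_space
    by (intro exI[of _ P] conjI ballI allI) auto
qed

section \<open>Order properties of the operator and its iterates\<close>

context generated_operator
begin

lemma finite_support: "x \<in> Y \<Longrightarrow> p \<in> P x \<Longrightarrow> finite (set_pmf p)"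
  using P_space finite_space finite_subset by blast

lemma mean_le_T:
  assumes "x \<in> Y" "p \<in> P x"
  shows "mean p f \<le> T f x"
  using assms T_Max finite_P by simp

lemma T_attained:
  assumes "x \<in> Y"
  obtains p where "p \<in> P x" "T f x = mean p f"
proof -
  have "Max ((\<lambda>p. mean p f) ` P x) \<in> (\<lambda>p. mean p f) ` P x"
    using assms finite_P P_nonempty by (intro Max_in) auto
  then show ?thesis using that T_Max[OF assms] by auto
qed

lemma edge_iff:
  "(x, y) \<in> accessibility_graph Y T \<longleftrightarrow> x \<in> Y \<and> (\<exists>p\<in>P x. y \<in> set_pmf p)"
proof (cases "x \<in> Y")
  case x: True
  show ?thesis
  proof
    assume "(x, y) \<in> accessibility_graph Y T"
    then have *: "T (indicator {y}) x > 0" by (simp add: accessibility_graph_def)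
    obtain p where "p \<in> P x" "T (indicator {y}) x = mean p (indicator {y})"
      using T_attained x by blast
    then show "x \<in> Y \<and> (\<exists>p\<in>P x. y \<in> set_pmf p)"
      using x * finite_support[of x p] by (auto simp: mean_indicator_singleton pmf_positive_iff)
  next
    assume "x \<in> Y \<and> (\<exists>p\<in>P x. y \<in> set_pmf p)"
    then obtain p where p: "p \<in> P x" "y \<in> set_pmf p" by blast
    have "0 < mean p (indicator {y})"
      using p x finite_support by (simp add: mean_indicator_singleton pmf_positive)
    then show "(x, y) \<in> accessibility_graph Y T"
      using mean_le_T[of x p "indicator {y}"] p x P_space by (force simp: accessibility_graph_def)
  qed
qed (simp add: accessibility_graph_def)

text \<open>An optimal generator for \<open>f\<close> at \<open>x\<close> only sees successors of
  \<open>x\<close>. Applied in both directions, this shows that \<open>T f x\<close> depends only on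
  the values of \<open>f\<close> there.\<close>

lemma T_mono_edges:
  assumes "x \<in> Y" "\<And>y. (x, y) \<in> accessibility_graph Y T \<Longrightarrow> f y \<le> g y"
  shows "T f x \<le> T g x"
proof -
  obtain p where p: "p \<in> P x" and "T f x = mean p f" using T_attained assms by blast
  note this(2)
  also have "mean p f \<le> mean p g"
    using p assms by (intro mean_mono) (auto simp: edge_iff)
  also have "\<dots> \<le> T g x" using p assms by (intro mean_le_T)
  finally show ?thesis .
qed

lemma edge_target: "(x, y) \<in> accessibility_graph Y T \<Longrightarrow> y \<in> Y"
  by (simp add: accessibility_graph_def)

lemma T_affine:
  assumes "x \<in> Y" "b \<ge> 0"
  shows "T (\<lambda>y. a + b * f y) x = a + b * T f x"
proof (rule antisym)
  obtain p where p: "p \<in> P x" "T (\<lambda>y. a + b * f y) x = mean p (\<lambda>y. a + b * f y)"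
    using T_attained assms by blast
  then show "T (\<lambda>y. a + b * f y) x \<le> a + b * T f x"
    using mean_le_T[of x p f] assms finite_support by (auto simp: mean_affine mult_left_mono)
  obtain q where q: "q \<in> P x" "T f x = mean q f"
    using T_attained assms by blast
  then show "a + b * T f x \<le> T (\<lambda>y. a + b * f y) x"
    using mean_le_T[of x q "\<lambda>y. a + b * f y"] assms finite_support by (auto simp: mean_affine)
qed

lemma T_const: "x \<in> Y \<Longrightarrow> T (\<lambda>y. c) x = c"
  using T_affine[of x 0 c "\<lambda>_. 0"] by simp

text \<open>No generator at a point of the closed set \<open>C\<close> charges its complement. Used
  with the whole space and with maximal classes as \<open>C\<close>.\<close>

lemma iter_mono_closed:
  assumes C: "C \<subseteq> Y" "\<And>x y. x \<in> C \<Longrightarrow> (x, y) \<in> accessibility_graph Y T \<Longrightarrow> y \<in> C"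
    and le: "\<And>y. y \<in> C \<Longrightarrow> f y \<le> g y" and x: "x \<in> C"
  shows "(T ^^ n) f x \<le> (T ^^ n) g x"
  using x
proof (induction n arbitrary: x)
  case (Suc n)
  then show ?case using C by (auto intro: T_mono_edges)
qed (use le in auto)

lemma iter_mono:
  assumes "\<And>y. y \<in> Y \<Longrightarrow> f y \<le> g y" "x \<in> Y"
  shows "(T ^^ n) f x \<le> (T ^^ n) g x"
  using assms edge_target by (intro iter_mono_closed[where C = Y]) auto

lemma iter_affine:
  assumes "x \<in> Y" "b \<ge> 0"
  shows "(T ^^ n) (\<lambda>y. a + b * f y) x = a + b * (T ^^ n) f x"
  using assms(1)
proof (induction n arbitrary: x)
  case (Suc n)
  have "T ((T ^^ n) (\<lambda>y. a + b * f y)) x = T (\<lambda>y. a + b * (T ^^ n) f y) x"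
    using Suc edge_target by (intro antisym T_mono_edges) fastforce+
  then show ?case using T_affine Suc.prems assms(2) by simp
qed simp

lemma iter_const: "x \<in> Y \<Longrightarrow> (T ^^ n) (\<lambda>y. c) x = c"
  using iter_affine[of x 0 n c "\<lambda>_. 0"] by simp

lemma iter_le_add_closed:
  assumes C: "C \<subseteq> Y" "\<And>x y. x \<in> C \<Longrightarrow> (x, y) \<in> accessibility_graph Y T \<Longrightarrow> y \<in> C"
    and le: "\<And>y. y \<in> C \<Longrightarrow> f y \<le> e + g y" and x: "x \<in> C"
  shows "(T ^^ n) f x \<le> e + (T ^^ n) g x"
proof -
  have "(T ^^ n) f x \<le> (T ^^ n) (\<lambda>y. e + 1 * g y) x"
    using le x C by (intro iter_mono_closed[where C = C]) auto
  then show ?thesis using x C(1) iter_affine[of x 1 n e g] by auto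
qed

lemma iter_le_add:
  assumes "\<And>y. y \<in> Y \<Longrightarrow> f y \<le> e + g y" "x \<in> Y"
  shows "(T ^^ n) f x \<le> e + (T ^^ n) g x"
  using assms edge_target by (intro iter_le_add_closed[where C = Y]) auto

lemma iter_nonexpansive:
  assumes "\<And>y. y \<in> Y \<Longrightarrow> \<bar>f y - g y\<bar> \<le> e" "x \<in> Y"
  shows "\<bar>(T ^^ n) f x - (T ^^ n) g x\<bar> \<le> e"
proof -
  have "f y \<le> e + g y" "g y \<le> e + f y" if "y \<in> Y" for y
    using assms(1)[OF that] by auto
  then show ?thesis
    using iter_le_add[of f e g x n] iter_le_add[of g e f x n] assms(2) by auto
qed

lemma iter_bounded:
  assumes "x \<in> Y"
  shows "\<bar>(T ^^ n) f x\<bar> \<le> (\<Sum>y\<in>Y. \<bar>f y\<bar>)"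
proof -
  have "\<bar>f y - 0\<bar> \<le> (\<Sum>y\<in>Y. \<bar>f y\<bar>)" if "y \<in> Y" for y
    using that finite_space by (auto intro: member_le_sum[of y Y "\<lambda>y. \<bar>f y\<bar>"])
  from iter_nonexpansive[OF this assms] show ?thesis by (simp add: iter_const assms)
qed

lemma iter_continuous:
  assumes lim: "\<And>y. y \<in> Y \<Longrightarrow> (\<lambda>k. u k y) \<longlonglongrightarrow> v y" and x: "x \<in> Y"
  shows "(\<lambda>k. (T ^^ n) (u k) x) \<longlonglongrightarrow> (T ^^ n) v x"
proof (rule Lim_null_comparison[THEN LIM_zero_cancel])
  show "\<forall>\<^sub>F k in sequentially. norm ((T ^^ n) (u k) x - (T ^^ n) v x) \<le> (\<Sum>y\<in>Y. \<bar>u k y - v y\<bar>)"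
    using x finite_space
    by (intro always_eventually allI) (auto intro!: iter_nonexpansive member_le_sum)
  have "(\<lambda>k. \<Sum>y\<in>Y. \<bar>u k y - v y\<bar>) \<longlonglongrightarrow> (\<Sum>y\<in>Y. \<bar>v y - v y\<bar>)"
    using lim by (intro tendsto_intros)
  then show "(\<lambda>k. \<Sum>y\<in>Y. \<bar>u k y - v y\<bar>) \<longlonglongrightarrow> 0" by simp
qed

section \<open>Maximal classes in the accessibility graph\<close>

lemma maximal_class:
  assumes "C \<in> maximal_classes Y T"
  shows "C \<subseteq> Y" "C \<noteq> {}"
    and "\<And>x y. x \<in> C \<Longrightarrow> (x, y) \<in> accessibility_graph Y T \<Longrightarrow> y \<in> C"
    and "\<And>x y. x \<in> C \<Longrightarrow> y \<in> C \<Longrightarrow> (x, y) \<in> (accessibility_graph Y T \<inter> C \<times> C)\<^sup>*"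
proof -
  let ?G = "accessibility_graph Y T"
  obtain z where z: "z \<in> Y"
    and C: "C = {y \<in> Y. (z, y) \<in> ?G\<^sup>* \<and> (y, z) \<in> ?G\<^sup>*}"
    and max: "\<And>x y. x \<in> C \<Longrightarrow> y \<in> Y - C \<Longrightarrow> (x, y) \<notin> ?G\<^sup>*"
  proof -
    have "C \<in> communication_classes Y T"
      and max: "\<And>x y. x \<in> C \<Longrightarrow> y \<in> Y - C \<Longrightarrow> (x, y) \<notin> ?G\<^sup>*"
      using assms by (auto simp: maximal_classes_def accessible_def)
    then show ?thesis
      using that unfolding communication_classes_def quotient_def accessible_def by blast
  qed
  show "C \<subseteq> Y" "C \<noteq> {}" using z C by auto
  show closed: "y \<in> C" if "x \<in> C" "(x, y) \<in> ?G" for x y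
    using max[of x y] that edge_target by blast
  show "(x, y) \<in> (?G \<inter> C \<times> C)\<^sup>*" if "x \<in> C" "y \<in> C" for x y
  proof -
    have "(x, y) \<in> ?G\<^sup>*" using that C by (auto intro: rtrancl_trans)
    \<comment> \<open>Membership of the endpoint is carried along so that closedness keeps the whole
      path inside \<open>C\<close>.\<close>
    then have "(x, y) \<in> (?G \<inter> C \<times> C)\<^sup>* \<and> y \<in> C"
    proof (induction rule: rtrancl_induct)
      case (step y z)
      then show ?case using closed by (meson IntI SigmaI rtrancl.rtrancl_into_rtrancl)
    qed (use that in auto)
    then show ?thesis by blast
  qed
qed

text \<open>A state whose reachable set has least cardinality lies in such a class: every state it
  reaches has the same reachable set and therefore leads back.\<close>

lemma maximal_class_exists:
  assumes "Y \<noteq> {}"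
  shows "\<exists>C. C \<in> maximal_classes Y T"
proof -
  let ?G = "accessibility_graph Y T"
  define E where "E = {(x, y). x \<in> Y \<and> y \<in> Y \<and> accessible Y T x y \<and> accessible Y T y x}"
  define reach where "reach x = {y \<in> Y. (x, y) \<in> ?G\<^sup>*}" for x
  obtain x where x: "x \<in> Y" and min: "\<And>y. y \<in> Y \<Longrightarrow> card (reach x) \<le> card (reach y)"
    using assms ex_has_least_nat[of "\<lambda>x. x \<in> Y" _ "\<lambda>x. card (reach x)"] by blast
  have sym: "(y, x) \<in> ?G\<^sup>*" if y: "y \<in> reach x" for y
  proof -
    have "reach y \<subseteq> reach x" using y by (auto simp: reach_def intro: rtrancl_trans)
    moreover have "finite (reach x)" using finite_space by (simp add: reach_def)
    ultimately have "reach y = reach x"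
      using min[of y] y by (intro card_seteq) (auto simp: reach_def)
    then show ?thesis using x by (auto simp: reach_def)
  qed
  have E: "E `` {x} = reach x"
    using x sym by (auto simp: E_def reach_def accessible_def)
  have "\<not> accessible Y T a b" if "a \<in> reach x" "b \<in> Y - reach x" for a b
    using that by (auto simp: reach_def accessible_def dest: rtrancl_trans)
  then have "E `` {x} \<in> maximal_classes Y T"
    using quotientI[OF x, of E] E
    unfolding maximal_classes_def communication_classes_def E_def[symmetric] by auto
  then show ?thesis by blast
qed

lemma path_positive:
  assumes "(x, y) \<in> accessibility_graph Y T ^^ n" "x \<in> Y"
  shows "(T ^^ n) (indicator {y}) x > 0"
  using assms
proof (induction n arbitrary: x)
  case (Suc n)
  then obtain z where z: "(x, z) \<in> accessibility_graph Y T" "(z, y) \<in> accessibility_graph Y T ^^ n"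
    by (meson relpow_Suc_D2)
  then have "z \<in> Y" by (simp add: edge_target)
  then have pos: "(T ^^ n) (indicator {y}) z > 0" using Suc.IH z by blast
  obtain p where p: "p \<in> P x" "z \<in> set_pmf p" using z edge_iff by auto
  have ge0: "(T ^^ n) (indicator {y}) w \<ge> 0" if "w \<in> Y" for w
    using iter_mono[of "\<lambda>_. 0" "indicator {y}" w n] that iter_const[of w n 0] by simp
  have "0 < mean p ((T ^^ n) (indicator {y}))"
    using mean_strict_mono[of p "\<lambda>_. 0" _ z] mean_const[of p 0] p pos ge0
      finite_support P_space Suc.prems(2) by (metis subsetD)
  also have "\<dots> \<le> T ((T ^^ n) (indicator {y})) x"
    using p Suc.prems(2) by (intro mean_le_T)
  finally show ?case by simp
qed simp

section \<open>Maximal classes\<close>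

abbreviation (input) "absorbing \<equiv> \<Union>(maximal_classes Y T)"

lemma absorbing_closed:
  assumes "x \<in> absorbing" "(x, y) \<in> accessibility_graph Y T"
  shows "y \<in> absorbing"
  using assms maximal_class(3) by blast

text \<open>If the period \<open>D\<close> is not 1, the states of \<open>C\<close> split into
  cyclic subclasses visited in turn, and the indicator of the one containing \<open>x0\<close> has
  iterates that keep switching between 0 and 1 at \<open>x0\<close>.\<close>

lemma convergent_imp_regular:
  assumes conv: "convergent_operator Y T" and C: "C \<in> maximal_classes Y T"
  shows "regular_class Y T C"
proof (rule ccontr)
  let ?G = "accessibility_graph Y T"
  define R where "R = ?G \<inter> C \<times> C"
  define D where "D = Gcd {n::nat. n \<ge> 1 \<and> (\<exists>x\<in>C. (x, x) \<in> R ^^ n)}"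
  assume "\<not> regular_class Y T C"
  then have D1: "D \<noteq> 1" by (simp add: regular_class_def D_def R_def)
  obtain x0 where x0: "x0 \<in> C" using maximal_class(2)[OF C] by blast
  then have "x0 \<in> Y" using maximal_class(1)[OF C] by blast
  have path: "\<exists>k. (x, y) \<in> R ^^ k" if "x \<in> C" "y \<in> C" for x y
    using maximal_class(4)[OF C that] by (simp add: R_def rtrancl_power)
  have step: "(x, y) \<in> R" if "x \<in> C" "(x, y) \<in> ?G" for x y
    using that maximal_class(3)[OF C] by (auto simp: R_def)
  have D_dvd: "D dvd n" if "(x0, x0) \<in> R ^^ n" for n
    using that x0 unfolding D_def by (cases "n = 0") (auto intro!: Gcd_dvd)
  \<comment> \<open>A closed walk of positive length at \<open>x0\<close> rules out
    \<open>D = 0\<close>.\<close>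
  obtain p y where "p \<in> P x0" "y \<in> set_pmf p"
    using P_nonempty[OF \<open>x0 \<in> Y\<close>] set_pmf_not_empty by fast
  then have y: "(x0, y) \<in> R" using step x0 \<open>x0 \<in> Y\<close> edge_iff by blast
  then have "y \<in> C" by (simp add: R_def)
  then obtain k where "(y, x0) \<in> R ^^ k" using path x0 by blast
  then have "(x0, x0) \<in> R ^^ Suc k" using y by (meson relpow_Suc_I2)
  then have "D dvd Suc k" by (rule D_dvd)
  then have "D > 1" using D1 by (cases D) auto
  define f :: "'a \<Rightarrow> real" where "f x = (if \<exists>k. (x0, x) \<in> R ^^ k \<and> D dvd k then 1 else 0)" for x
  \<comment> \<open>All successors of a state reached in \<open>k\<close> steps are reached in
    \<open>k + 1\<close> steps, so the previous iterate is constant on them and every generator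
    gives the same mean.\<close>
  have iter: "(T ^^ n) f x = (if D dvd n + k then 1 else 0)" if "(x0, x) \<in> R ^^ k" "x \<in> C" for n x k
    using that
  proof (induction n arbitrary: x k)
    case 0
    obtain b where b: "(x, x0) \<in> R ^^ b" using path 0 x0 by blast
    \<comment> \<open>Two walks from \<open>x0\<close> to \<open>x\<close>, closed up by the same
      walk back, have lengths congruent modulo \<open>D\<close>.\<close>
    have "D dvd k" if "(x0, x) \<in> R ^^ j" "D dvd j" for j
    proof -
      have "D dvd j + b" "D dvd k + b" using that b 0 D_dvd relpow_trans by metis+
      then show ?thesis using \<open>D dvd j\<close> by (metis dvd_add_right_iff dvd_add_left_iff)
    qed
    then show ?case using 0 by (auto simp: f_def)
  next
    case (Suc n)
    have "x \<in> Y" using Suc.prems maximal_class(1)[OF C] by blast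
    have "(T ^^ n) f y = (if D dvd n + Suc k then 1 else 0)" if "(x, y) \<in> ?G" for y
      using Suc.IH[of y "Suc k"] Suc.prems that step maximal_class(3)[OF C] relpow_Suc_I
      by metis
    then have "T ((T ^^ n) f) x = T (\<lambda>y. if D dvd n + Suc k then 1 else 0) x"
      using \<open>x \<in> Y\<close> by (intro antisym T_mono_edges) auto
    then show ?case using T_const[OF \<open>x \<in> Y\<close>] by simp
  qed
  have val: "(T ^^ n) f x0 = (if D dvd n then 1 else 0)" for n
    using iter[of x0 0 n] x0 by simp
  obtain l where l: "(\<lambda>n. (T ^^ n) f x0) \<longlonglongrightarrow> l"
    using conv \<open>x0 \<in> Y\<close> by (auto simp: convergent_operator_def convergent_def)
  have "strict_mono (\<lambda>k. D * k)" "strict_mono (\<lambda>k. D * k + 1)"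
    using \<open>D > 1\<close> by (auto simp: strict_mono_def)
  from this[THEN LIMSEQ_subseq_LIMSEQ[OF l]]
  have "(\<lambda>k. 1 :: real) \<longlonglongrightarrow> l" "(\<lambda>k. 0 :: real) \<longlonglongrightarrow> l"
    using D1 by (simp_all add: o_def val nat_dvd_1_iff_1[unfolded One_nat_def]
        dvd_add_right_iff flip: One_nat_def)
  then show False by (simp add: LIMSEQ_const_iff)
qed

text \<open>A Doeblin argument: in \<open>N\<close> steps the minimum over \<open>C\<close> rises by
  at least a fixed fraction \<delta> of the oscillation, while the maximum never rises, so their
  monotone limits coincide.\<close>

lemma regular_imp_convergent:
  assumes C: "C \<in> maximal_classes Y T" and reg: "regular_class Y T C" and x: "x \<in> C"
  shows "convergent (\<lambda>n. (T ^^ n) f x)"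
proof -
  let ?G = "accessibility_graph Y T"
  note closed = maximal_class(1,3)[OF C]
  have fin: "finite C" using closed(1) finite_space finite_subset by blast
  have "\<exists>N. \<forall>x\<in>C. \<forall>y\<in>C. (x, y) \<in> (?G \<inter> C \<times> C) ^^ N"
    using fin maximal_class(2,4)[OF C] reg unfolding regular_class_def
    by (intro primitive_relation) auto
  then obtain N where N: "\<And>x y. x \<in> C \<Longrightarrow> y \<in> C \<Longrightarrow> (x, y) \<in> (?G \<inter> C \<times> C) ^^ N" by blast
  \<comment> \<open>The least \<open>N\<close>-step upper probability between two states of
    \<open>C\<close>; it is positive because walks of length \<open>N\<close> join all
    pairs.\<close>
  define \<delta> where "\<delta> = Min ((\<lambda>(x, y). (T ^^ N) (indicator {y}) x) ` (C \<times> C))"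
  have "(T ^^ N) (indicator {y}) x > 0" if "x \<in> C" "y \<in> C" for x y
    using path_positive[of x y N] relpow_mono[OF N[OF that], of ?G] that closed(1) by blast
  then have \<delta>: "\<delta> > 0"
    unfolding \<delta>_def using fin x by (subst Min_gr_iff) auto
  have \<delta>_le: "\<delta> \<le> (T ^^ N) (indicator {y}) x" if "x \<in> C" "y \<in> C" for x y
    unfolding \<delta>_def using fin that by (intro Min_le) force+
  have le: "(T ^^ k) F z \<le> c" if "\<And>y. y \<in> C \<Longrightarrow> F y \<le> c" "z \<in> C" for k F c z
    using iter_mono_closed[where C = C and g = "\<lambda>_. c" and f = F and x = z and n = k]
      that closed iter_const[of z k c] by auto
  have ge: "c \<le> (T ^^ k) F z" if "\<And>y. y \<in> C \<Longrightarrow> c \<le> F y" "z \<in> C" for k F c z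
    using iter_mono_closed[where C = C and f = "\<lambda>_. c" and g = F and x = z and n = k]
      that closed iter_const[of z k c] by auto
  define u where "u n = (T ^^ n) f" for n
  have u_add: "u (n + k) = (T ^^ k) (u n)" for n k
    unfolding u_def by (metis add.commute comp_apply funpow_add)
  define a where "a n = Max (u n ` C)" for n
  define b where "b n = Min (u n ` C)" for n
  have a_ge: "u n y \<le> a n" and b_le: "b n \<le> u n y" if "y \<in> C" for n y
    using that fin by (auto simp: a_def b_def)
  have a_mono: "a (n + k) \<le> a n" for n k
    unfolding a_def[of "n + k"] u_add using fin x le[OF a_ge] by (subst Max_le_iff) auto
  have b_mono: "b n \<le> b (n + k)" for n k
    unfolding b_def[of "n + k"] u_add using fin x ge[OF b_le] by (subst Min_ge_iff) auto
  \<comment> \<open>For a maximiser \<open>y\<close> of \<open>u n\<close>, the function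
    \<open>b n + (a n - b n) * indicator {y} z\<close> of \<open>z\<close> lies below
    \<open>u n\<close> on \<open>C\<close>, and by affinity its iterates reduce to those of the
    indicator.\<close>
  have contraction: "b n + (a n - b n) * \<delta> \<le> b (n + N)" for n
  proof -
    have "a n \<in> u n ` C" unfolding a_def using fin x by (intro Max_in) auto
    then obtain y where y: "y \<in> C" "u n y = a n" by auto
    have "b n \<le> a n" using a_ge b_le x by (meson order_trans)
    have "b n + (a n - b n) * \<delta> \<le> u (n + N) z" if z: "z \<in> C" for z
    proof -
      have "(a n - b n) * \<delta> \<le> (a n - b n) * (T ^^ N) (indicator {y}) z"
        using \<open>b n \<le> a n\<close> \<delta>_le[OF z y(1)] by (intro mult_left_mono) auto
      also have "b n + \<dots> = (T ^^ N) (\<lambda>z. b n + (a n - b n) * indicator {y} z) z"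
        using \<open>b n \<le> a n\<close> z closed(1) by (subst iter_affine) auto
      also have "\<dots> \<le> u (n + N) z"
        unfolding u_add using z closed y b_le
        by (intro iter_mono_closed[where C = C]) (auto simp: indicator_def)
      finally show ?thesis by simp
    qed
    then show ?thesis
      unfolding b_def[of "n + N"] using fin x by (subst Min_ge_iff) auto
  qed
  have "\<bar>u n x\<bar> \<le> (\<Sum>y\<in>Y. \<bar>f y\<bar>)" for n
    unfolding u_def using x closed(1) by (intro iter_bounded) auto
  then have bound: "u n x \<le> (\<Sum>y\<in>Y. \<bar>f y\<bar>)" "- (\<Sum>y\<in>Y. \<bar>f y\<bar>) \<le> u n x" for n
    by (auto simp: abs_le_iff minus_le_iff)
  have "decseq a" "incseq b"
    using a_mono b_mono by (auto simp: decseq_def incseq_def dest!: le_Suc_ex)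
  have "\<And>n. - (\<Sum>y\<in>Y. \<bar>f y\<bar>) \<le> a n" "\<And>n. b n \<le> (\<Sum>y\<in>Y. \<bar>f y\<bar>)"
    using bound a_ge[OF x] b_le[OF x] order_trans by blast+
  then obtain \<alpha> \<beta> where lim: "a \<longlonglongrightarrow> \<alpha>" "b \<longlonglongrightarrow> \<beta>"
    using decseq_convergent[OF \<open>decseq a\<close>] incseq_convergent[OF \<open>incseq b\<close>] by metis
  have "\<beta> + (\<alpha> - \<beta>) * \<delta> \<le> \<beta>"
  proof (rule LIMSEQ_le)
    show "(\<lambda>n. b n + (a n - b n) * \<delta>) \<longlonglongrightarrow> \<beta> + (\<alpha> - \<beta>) * \<delta>"
      using lim by (intro tendsto_intros)
    show "(\<lambda>n. b (n + N)) \<longlonglongrightarrow> \<beta>" using lim(2) by (rule LIMSEQ_ignore_initial_segment)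
  qed (use contraction in blast)
  then have "\<alpha> \<le> \<beta>" using \<delta> by (simp add: mult_le_0_iff)
  moreover have "\<beta> \<le> \<alpha>"
    using LIMSEQ_le[OF lim(2,1)] a_ge[OF x] b_le[OF x] by (meson order_trans)
  ultimately have "\<alpha> = \<beta>" by simp
  then have "(\<lambda>n. u n x) \<longlonglongrightarrow> \<alpha>"
    using lim a_ge[OF x] b_le[OF x]
    by (intro tendsto_sandwich[of b "\<lambda>n. u n x" _ a] always_eventually allI) simp_all
  then show ?thesis by (auto simp: convergent_def u_def)
qed

section \<open>States that can avoid the maximal classes\<close>

text \<open>The states from which a suitable choice of generators keeps the process outside the
  maximal classes at time \<open>n\<close>.\<close>

primrec staying :: "nat \<Rightarrow> 'a set" where
  "staying 0 = Y - absorbing"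
| "staying (Suc n) = {x \<in> Y. \<exists>p\<in>P x. set_pmf p \<subseteq> staying n}"

lemma staying_subset: "staying n \<subseteq> Y"
  by (cases n) auto

text \<open>The iterate is minus the lower probability of being in the maximal classes after
  \<open>n\<close> steps. The largest mean of a nonpositive function vanishes iff some generator is
  supported in its zeros, which is the recursion of \<open>staying\<close>.\<close>

lemma iter_absorbing:
  assumes "x \<in> Y"
  shows "(T ^^ n) (\<lambda>y. - indicator absorbing y) x \<le> 0 \<and>
    ((T ^^ n) (\<lambda>y. - indicator absorbing y) x = 0 \<longleftrightarrow> x \<in> staying n)"
  using assms
proof (induction n arbitrary: x)
  case 0
  then show ?case by (auto simp: indicator_def)
next
  case (Suc n)
  define w where "w = (T ^^ n) (\<lambda>y. - indicator absorbing y)"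
  have w: "w y \<le> 0" "w y = 0 \<longleftrightarrow> y \<in> staying n" if "y \<in> Y" for y
    using Suc.IH[OF that] by (auto simp: w_def)
  obtain p where p: "p \<in> P x" "T w x = mean p w" using T_attained Suc.prems by blast
  note supp = P_space[OF Suc.prems] finite_support[OF Suc.prems]
  have "T w x \<le> 0"
    using p supp w by (auto intro!: mean_le_const)
  moreover have "x \<in> staying (Suc n)" if "T w x = 0"
  proof -
    have "w y = 0" if "y \<in> set_pmf p" for y
    proof (rule ccontr)
      assume "w y \<noteq> 0"
      then have "mean p w < 0"
        using w supp p that by (intro mean_less_const[of p w 0 y]) (auto simp: order_less_le subset_iff)
      then show False using p \<open>T w x = 0\<close> by simp
    qed
    then have "set_pmf p \<subseteq> staying n" using p w supp by blast
    then show ?thesis using p Suc.prems by auto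
  qed
  moreover have "T w x = 0" if "x \<in> staying (Suc n)"
  proof -
    obtain q where q: "q \<in> P x" "set_pmf q \<subseteq> staying n"
      using \<open>x \<in> staying (Suc n)\<close> by auto
    have "w y = 0" if "y \<in> set_pmf q" for y
      using that q(2) staying_subset w(2) by blast
    then have "0 \<le> mean q w"
      using supp(2)[OF q(1)] by (intro mean_ge_const) auto
    also have "\<dots> \<le> T w x" using q Suc.prems by (intro mean_le_T)
    finally show ?thesis using \<open>T w x \<le> 0\<close> by simp
  qed
  ultimately have "T w x \<le> 0 \<and> (T w x = 0 \<longleftrightarrow> x \<in> staying (Suc n))" by blast
  then show ?case by (simp add: w_def)
qed

lemma iter_lower_operator: "(lower_operator T ^^ n) f x = - (T ^^ n) (\<lambda>y. - f y) x"
proof -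
  have "(lower_operator T ^^ n) f = (\<lambda>x. - (T ^^ n) (\<lambda>y. - f y) x)"
    by (induction n) (simp_all add: lower_operator_def)
  then show ?thesis by simp
qed

text \<open>By \<open>iter_absorbing\<close>, failure of lower reachability is membership in
  \<open>staying n\<close> for all \<open>n \<ge> 1\<close>; the case \<open>n = 0\<close> accounts
  for lying outside the maximal classes.\<close>

lemma non_absorbed_eq: "non_absorbed Y T = {x \<in> Y. \<forall>n. x \<in> staying n}"
proof -
  have "lower_reachable T absorbing x \<longleftrightarrow> (\<exists>n\<ge>1. x \<notin> staying n)" if "x \<in> Y" for x
    using iter_absorbing[OF that] unfolding lower_reachable_def iter_lower_operator
    by (metis neg_0_less_iff_less order_less_le)
  then have "x \<in> non_absorbed Y T \<longleftrightarrow> x \<in> Y \<and> x \<in> staying 0 \<and> (\<forall>n\<ge>1. x \<in> staying n)" for x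
    unfolding non_absorbed_def by auto
  moreover have "(\<forall>n. x \<in> staying n) \<longleftrightarrow> x \<in> staying 0 \<and> (\<forall>n\<ge>1. x \<in> staying n)" for x
    by (metis less_one not_less)
  ultimately show ?thesis by blast
qed

lemma non_absorbed_subset: "non_absorbed Y T \<subseteq> Y"
  by (auto simp: non_absorbed_def)

text \<open>Closedness of the maximal classes gives the first inclusion, and the recursion is
  monotone in the previous set.\<close>

lemma staying_antimono: "m \<le> n \<Longrightarrow> staying n \<subseteq> staying m"
proof (rule lift_Suc_antimono_le[of staying])
  show "staying (Suc n) \<subseteq> staying n" for n
  proof (induction n)
    case 0
    have "x \<notin> absorbing" if x: "x \<in> Y" and p: "p \<in> P x" "set_pmf p \<subseteq> Y - absorbing" for x p
    proof
      assume "x \<in> absorbing"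
      obtain y where y: "y \<in> set_pmf p" using set_pmf_not_empty by fast
      then have "(x, y) \<in> accessibility_graph Y T" using edge_iff x p by blast
      then show False using absorbing_closed \<open>x \<in> absorbing\<close> y p by blast
    qed
    then show ?case by auto
  next
    case (Suc n)
    show ?case
    proof
      fix x assume "x \<in> staying (Suc (Suc n))"
      then obtain p where "x \<in> Y" "p \<in> P x" "set_pmf p \<subseteq> staying (Suc n)" by auto
      then show "x \<in> staying (Suc n)" using order_trans[OF _ Suc, of "set_pmf p"] by auto
    qed
  qed
qed auto

lemma staying_eventually: "\<exists>N. \<forall>n\<ge>N. staying n = non_absorbed Y T"
proof -
  have "\<forall>y\<in>Y - non_absorbed Y T. \<exists>n. y \<notin> staying n" by (auto simp: non_absorbed_eq)
  then obtain h where h: "\<And>y. y \<in> Y - non_absorbed Y T \<Longrightarrow> y \<notin> staying (h y)" by metis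
  define N where "N = Max (insert 0 (h ` Y))"
  have "staying n \<subseteq> non_absorbed Y T" if "n \<ge> N" for n
  proof
    fix y assume y: "y \<in> staying n"
    then have "y \<in> Y" using staying_subset by blast
    then have "h y \<le> N" unfolding N_def using finite_space by (intro Max_ge) auto
    then have "y \<in> staying (h y)" using y staying_antimono[of "h y" n] that by auto
    then show "y \<in> non_absorbed Y T" using h \<open>y \<in> Y\<close> by blast
  qed
  then show ?thesis by (metis (mono_tags, lifting) mem_Collect_eq non_absorbed_eq subsetI subset_antisym)
qed

text \<open>The eventual value of \<open>staying\<close> is a fixed point of its recursion.\<close>

lemma non_absorbed_iff:
  assumes "x \<in> Y"
  shows "x \<in> non_absorbed Y T \<longleftrightarrow> (\<exists>p\<in>P x. set_pmf p \<subseteq> non_absorbed Y T)"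
proof -
  obtain N where "\<And>n. n \<ge> N \<Longrightarrow> staying n = non_absorbed Y T" using staying_eventually by blast
  from this[of N] this[of "Suc N"] assms show ?thesis by auto
qed

section \<open>Generators of the restricted operator\<close>

definition inner_P :: "'a \<Rightarrow> 'a pmf set" where
  "inner_P x = {p \<in> P x. set_pmf p \<subseteq> non_absorbed Y T}"

text \<open>Every generator outside \<open>inner_P x\<close> charges a point where \<open>w\<close>
  is negative; as there are only finitely many generators in total, their means share a negative
  upper bound. This uniform loss sets the size of the penalties below.\<close>

lemma mean_bounded_away:
  assumes "\<And>y. y \<in> Y \<Longrightarrow> w y \<le> 0" and "\<And>y. y \<in> Y - non_absorbed Y T \<Longrightarrow> w y < 0"
  shows "\<exists>\<epsilon>>0. \<forall>x\<in>Y. \<forall>p\<in>P x - inner_P x. mean p w \<le> - \<epsilon>"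
proof -
  define W where "W = (\<Union>x\<in>Y. (\<lambda>p. - mean p w) ` (P x - inner_P x))"
  \<comment> \<open>The element 1 keeps the minimum meaningful when no generator leaves
    \<open>non_absorbed Y T\<close>.\<close>
  have fin: "finite (insert 1 W)" unfolding W_def using finite_space finite_P by auto
  have "mean p w < 0" if x: "x \<in> Y" and p: "p \<in> P x - inner_P x" for x p
  proof -
    obtain y where "y \<in> set_pmf p" "y \<notin> non_absorbed Y T" using p by (auto simp: inner_P_def)
    then show ?thesis
      using assms P_space[OF x] finite_support[OF x] p
      by (intro mean_less_const[of p w 0 y]) (auto simp: subset_iff)
  qed
  then have "\<forall>e\<in>insert 1 W. e > 0" by (auto simp: W_def)
  then have "Min (insert 1 W) > 0" using fin by (subst Min_gr_iff) auto
  moreover have "mean p w \<le> - Min (insert 1 W)" if "x \<in> Y" "p \<in> P x - inner_P x" for x p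
  proof -
    have "- mean p w \<in> insert 1 W" using that by (auto simp: W_def)
    then have "Min (insert 1 W) \<le> - mean p w" using fin by (intro Min_le)
    then show ?thesis by simp
  qed
  ultimately show ?thesis by blast
qed

text \<open>A large penalty outside \<open>non_absorbed Y T\<close> rules out all generators other than those
  in \<open>inner_P x\<close>; this avoids computing the credal sets as convex hulls.\<close>

lemma restricted_operator_Max:
  assumes x: "x \<in> non_absorbed Y T"
  shows "restricted_operator Y T (non_absorbed Y T) g x = Max ((\<lambda>p. mean p g) ` inner_P x)"
proof -
  let ?Z = "non_absorbed Y T"
  have xY: "x \<in> Y" using x non_absorbed_subset by blast
  have finZ: "finite ?Z" using non_absorbed_subset finite_space finite_subset by blast
  have fin: "finite (inner_P x)" "inner_P x \<noteq> {}"
    using finite_P[OF xY] non_absorbed_iff[OF xY] x by (auto simp: inner_P_def)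
  define m where "m = Max ((\<lambda>p. mean p g) ` inner_P x)"
  have m: "m \<in> (\<lambda>p. mean p g) ` inner_P x" "\<And>p. p \<in> inner_P x \<Longrightarrow> mean p g \<le> m"
    using fin by (auto simp: m_def intro!: Max_in)
  have support: "set_pmf q \<subseteq> ?Z" if "q \<in> restricted_credal_set Y T ?Z x" for q
    using that by (auto simp: restricted_credal_set_def credal_set_def set_pmf_iff)
  define w :: "'a \<Rightarrow> real" where "w y = (if y \<in> ?Z then 0 else -1)" for y
  obtain \<epsilon> where \<epsilon>: "\<epsilon> > 0" "\<And>p. p \<in> P x - inner_P x \<Longrightarrow> mean p w \<le> - \<epsilon>"
  proof -
    have "\<exists>\<epsilon>>0. \<forall>x\<in>Y. \<forall>p\<in>P x - inner_P x. mean p w \<le> - \<epsilon>"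
      by (intro mean_bounded_away) (auto simp: w_def)
    then show ?thesis using that xY by blast
  qed
  define G where "G = \<bar>m\<bar> + (\<Sum>y\<in>?Z. \<bar>g y\<bar>)"
  \<comment> \<open>With this \<open>K\<close>, a generator that leaves \<open>?Z\<close> gives
    \<open>f\<close> a mean of at most \<open>G - K * \<epsilon> = m\<close>, the value of the best
    inner generator.\<close>
  define K where "K = (G - m) / \<epsilon>"
  have "m \<le> G" unfolding G_def using sum_nonneg[of ?Z "\<lambda>y. \<bar>g y\<bar>"] by linarith
  then have K: "K \<ge> 0" "G - K * \<epsilon> = m" using \<epsilon>(1) by (auto simp: K_def)
  have gG: "g y \<le> G" if "y \<in> ?Z" for y
    using member_le_sum[of y ?Z "\<lambda>y. \<bar>g y\<bar>"] that finZ by (auto simp: G_def)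
  define f where "f y = (if y \<in> ?Z then g y else G + K * w y)" for y
  have f_le: "f y \<le> G + K * w y" for y using gG by (auto simp: f_def w_def)
  have "T f x \<le> m"
  proof -
    obtain p where p: "p \<in> P x" "T f x = mean p f" using T_attained xY by blast
    show ?thesis
    proof (cases "p \<in> inner_P x")
      case True
      then have "mean p f = mean p g" by (intro mean_cong) (auto simp: inner_P_def f_def)
      then show ?thesis using m True p by simp
    next
      case False
      have "mean p f \<le> mean p (\<lambda>y. G + K * w y)" using f_le by (intro mean_mono)
      also have "\<dots> = G + K * mean p w" using p xY finite_support by (intro mean_affine)
      also have "\<dots> \<le> G + K * - \<epsilon>"
        using \<epsilon>(2)[of p] p False K by (intro add_left_mono mult_left_mono) auto
      finally show ?thesis using K p by simp
    qed
  qed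
  \<comment> \<open>On the support of \<open>q\<close> the functions \<open>f\<close> and
    \<open>g\<close> agree, so the credal inequality at this single \<open>f\<close> gives the
    bound.\<close>
  have upper: "(\<Sum>y\<in>?Z. pmf q y * g y) \<le> m" if q: "q \<in> restricted_credal_set Y T ?Z x" for q
  proof -
    have "(\<Sum>y\<in>?Z. pmf q y * g y) = mean q f"
      unfolding mean_eq_sum[OF finZ support[OF q]]
      using support[OF q] by (intro mean_cong) (auto simp: f_def)
    also have "\<dots> = (\<Sum>y\<in>Y. pmf q y * f y)"
      using support[OF q] non_absorbed_subset finite_space by (intro mean_eq_sum[symmetric]) auto
    also have "\<dots> \<le> T f x"
      using q by (auto simp: restricted_credal_set_def credal_set_def)
    finally show ?thesis using \<open>T f x \<le> m\<close> by simp
  qed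
  have sub: "p \<in> restricted_credal_set Y T ?Z x" if p: "p \<in> inner_P x" for p
  proof -
    have "p \<in> P x" "set_pmf p \<subseteq> ?Z" using p by (auto simp: inner_P_def)
    then show ?thesis
      using mean_le_T[OF xY] mean_eq_sum[OF finite_space P_space[OF xY]] P_space[OF xY]
      by (auto simp: restricted_credal_set_def credal_set_def set_pmf_iff)
  qed
  obtain p where p: "p \<in> inner_P x" "m = mean p g" using m by blast
  have "m = (\<Sum>y\<in>?Z. pmf p y * g y)"
    using p mean_eq_sum[OF finZ, of p g] by (auto simp: inner_P_def)
  then have "m \<in> (\<lambda>q. \<Sum>y\<in>?Z. pmf q y * g y) ` restricted_credal_set Y T ?Z x"
    using sub p by blast
  then show ?thesis
    unfolding restricted_operator_def m_def[symmetric] using upper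
    by (intro cSup_eq_maximum) auto
qed

text \<open>Makes everything proved for \<open>T\<close> available for its restriction, and so for
  all later stages.\<close>

lemma generated_restricted:
  "generated_operator (non_absorbed Y T) (restricted_operator Y T (non_absorbed Y T)) inner_P"
proof
  show "finite (non_absorbed Y T)" using non_absorbed_subset finite_space finite_subset by blast
  fix x assume x: "x \<in> non_absorbed Y T"
  then have "x \<in> Y" using non_absorbed_subset by blast
  then show "finite (inner_P x)" "inner_P x \<noteq> {}"
    using finite_P non_absorbed_iff x by (auto simp: inner_P_def)
qed (auto simp: inner_P_def restricted_operator_Max)

text \<open>One extension \<open>f\<close> of \<open>g\<close> serves all \<open>n\<close> at once,
  because \<open>T w \<le> w\<close> keeps every iterate of \<open>f\<close> below
  \<open>G + K * w\<close>.\<close>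

lemma iter_restricted:
  "\<exists>f. \<forall>n. \<forall>x\<in>non_absorbed Y T.
    (T ^^ n) f x = (restricted_operator Y T (non_absorbed Y T) ^^ n) g x"
proof -
  let ?Z = "non_absorbed Y T"
  interpret Z: generated_operator ?Z "restricted_operator Y T ?Z" inner_P
    by (rule generated_restricted)
  define S where "S = restricted_operator Y T ?Z"
  obtain N where N: "staying N = ?Z" using staying_eventually by blast
  define w where "w = (T ^^ N) (\<lambda>y. - indicator absorbing y)"
  have w: "w y \<le> 0" "w y = 0 \<longleftrightarrow> y \<in> ?Z" if "y \<in> Y" for y
    using iter_absorbing[OF that, of N] by (auto simp: w_def N)
  \<comment> \<open>The maximal classes are closed, so the inequality holds for minus their
    indicator; it passes to \<open>w\<close> because the iterates of \<open>T\<close> are monotone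
    and commute with \<open>T\<close>.\<close>
  have Tw: "T w y \<le> w y" if y: "y \<in> Y" for y
  proof -
    have "T (\<lambda>y. - indicator absorbing y) z \<le> - indicator absorbing z" if z: "z \<in> Y" for z
    proof -
      have "T (\<lambda>y. - indicator absorbing y) z \<le> T (\<lambda>y. - indicator absorbing z) z"
        using z absorbing_closed[of z]
        by (intro T_mono_edges) (auto simp: indicator_def split: if_splits)
      then show ?thesis using T_const[OF z] by simp
    qed
    then have "(T ^^ N) (T (\<lambda>y. - indicator absorbing y)) y \<le> w y"
      unfolding w_def using y by (intro iter_mono) auto
    then show ?thesis by (simp add: w_def funpow_swap1)
  qed
  have iter_w: "(T ^^ n) w y \<le> w y" if "y \<in> Y" for n y
    using that
  proof (induction n arbitrary: y)
    case (Suc n)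
    then have "T ((T ^^ n) w) y \<le> T w y" using edge_target by (intro T_mono_edges) auto
    then show ?case using Tw[OF Suc.prems] by simp
  qed simp
  have "\<exists>\<epsilon>>0. \<forall>x\<in>Y. \<forall>p\<in>P x - inner_P x. mean p w \<le> - \<epsilon>"
    using w by (intro mean_bounded_away) (auto simp: order_less_le)
  then obtain \<epsilon> where \<epsilon>: "\<epsilon> > 0" "\<And>x p. x \<in> Y \<Longrightarrow> p \<in> P x - inner_P x \<Longrightarrow> mean p w \<le> - \<epsilon>" by blast
  define G where "G = (\<Sum>y\<in>?Z. \<bar>g y\<bar>)"
  \<comment> \<open>The factor 2 pushes the value of leaving \<open>?Z\<close> from \<open>G\<close>
    down to \<open>- G\<close>, a lower bound for all iterates of \<open>S\<close> on
    \<open>?Z\<close>.\<close>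
  define K where "K = 2 * G / \<epsilon>"
  have "G \<ge> 0" by (simp add: G_def sum_nonneg)
  then have K: "K \<ge> 0" "G - K * \<epsilon> = - G" using \<epsilon>(1) by (auto simp: K_def)
  have bound: "\<bar>(S ^^ n) g x\<bar> \<le> G" if "x \<in> ?Z" for n x
    unfolding S_def G_def using that by (rule Z.iter_bounded)
  define f where "f y = (if y \<in> ?Z then g y else G + K * w y)" for y
  have f_le: "(T ^^ n) f y \<le> G + K * w y" if y: "y \<in> Y" for n y
  proof -
    have "f z \<le> G + K * w z" if "z \<in> Y" for z
      using bound[of z 0] w[OF that] by (auto simp: f_def)
    then have "(T ^^ n) f y \<le> (T ^^ n) (\<lambda>z. G + K * w z) y"
      using y by (intro iter_mono) auto
    also have "\<dots> = G + K * (T ^^ n) w y" using y K by (intro iter_affine)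
    also have "\<dots> \<le> G + K * w y" using iter_w[OF y] K by (intro add_left_mono mult_left_mono)
    finally show ?thesis .
  qed
  have "(T ^^ n) f x = (S ^^ n) g x" if "x \<in> ?Z" for n x
    using that
  proof (induction n arbitrary: x)
    case 0
    then show ?case by (simp add: f_def)
  next
    case (Suc n)
    have xY: "x \<in> Y" using Suc.prems non_absorbed_subset by blast
    have eq: "mean p ((T ^^ n) f) = mean p ((S ^^ n) g)" if "p \<in> inner_P x" for p
      using that Suc.IH by (intro mean_cong) (auto simp: inner_P_def)
    obtain p where p: "p \<in> P x" "T ((T ^^ n) f) x = mean p ((T ^^ n) f)"
      using T_attained xY by blast
    have "T ((T ^^ n) f) x \<le> S ((S ^^ n) g) x"
    proof (cases "p \<in> inner_P x")
      case True
      then show ?thesis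
        using p eq Z.mean_le_T[OF Suc.prems, of p "(S ^^ n) g"] by (simp add: S_def)
    next
      case False
      have "mean p ((T ^^ n) f) \<le> mean p (\<lambda>y. G + K * w y)"
        using f_le p P_space[OF xY] by (intro mean_mono) auto
      also have "\<dots> = G + K * mean p w" using p xY finite_support by (intro mean_affine)
      also have "\<dots> \<le> G + K * - \<epsilon>"
        using \<epsilon>(2)[OF xY, of p] p False K by (intro add_left_mono mult_left_mono) auto
      also have "\<dots> \<le> S ((S ^^ n) g) x" using K bound[OF Suc.prems, of "Suc n"] by simp
      finally show ?thesis using p by simp
    qed
    moreover
    obtain q where q: "q \<in> inner_P x" "S ((S ^^ n) g) x = mean q ((S ^^ n) g)"
      using Z.T_attained Suc.prems unfolding S_def by blast
    then have "S ((S ^^ n) g) x \<le> T ((T ^^ n) f) x"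
      using eq mean_le_T[OF xY, of q "(T ^^ n) f"] by (simp add: inner_P_def)
    ultimately show ?case by simp
  qed
  then show ?thesis unfolding S_def by blast
qed

lemma convergent_restricted:
  assumes "convergent_operator Y T"
  shows "convergent_operator (non_absorbed Y T) (restricted_operator Y T (non_absorbed Y T))"
  unfolding convergent_operator_def
proof (intro allI ballI)
  fix g x assume x: "x \<in> non_absorbed Y T"
  obtain f where f: "\<And>n. (T ^^ n) f x = (restricted_operator Y T (non_absorbed Y T) ^^ n) g x"
    using iter_restricted[of g] x by blast
  have "convergent (\<lambda>n. (T ^^ n) f x)"
    using assms x non_absorbed_subset by (auto simp: convergent_operator_def)
  then show "convergent (\<lambda>n. (restricted_operator Y T (non_absorbed Y T) ^^ n) g x)"
    by (simp add: f)
qed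

section \<open>Convergence from the restricted operator\<close>

lemma convergent_from_restricted:
  assumes absorbed: "\<And>x f. x \<in> absorbing \<Longrightarrow> convergent (\<lambda>n. (T ^^ n) f x)"
    and restricted: "convergent_operator (non_absorbed Y T) (restricted_operator Y T (non_absorbed Y T))"
  shows "convergent_operator Y T"
  unfolding convergent_operator_def
proof (intro allI ballI)
  fix f :: "'a \<Rightarrow> real" and x assume x: "x \<in> Y"
  let ?Z = "non_absorbed Y T"
  interpret Z: generated_operator ?Z "restricted_operator Y T ?Z" inner_P
    by (rule generated_restricted)
  define S where "S = restricted_operator Y T ?Z"
  define B where "B = (\<Sum>y\<in>Y. \<bar>f y\<bar>)"
  define u where "u n = (T ^^ n) f" for n
  have u_bound: "\<bar>u n y\<bar> \<le> B" if "y \<in> Y" for n y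
    unfolding u_def B_def using that by (rule iter_bounded)
  obtain r v where r: "strict_mono r" and v: "\<And>y. y \<in> Y \<Longrightarrow> (\<lambda>k. u (r k) y) \<longlonglongrightarrow> v y"
  proof -
    have "\<exists>r v. strict_mono (r :: nat \<Rightarrow> nat) \<and> (\<forall>y\<in>Y. (\<lambda>k. u (r k) y) \<longlonglongrightarrow> v y)"
      using finite_space u_bound by (rule finite_convergent_subsequence)
    then show ?thesis using that by auto
  qed
  define V where "V n = (T ^^ n) v" for n
  have u_add: "u (n + k) = (T ^^ n) (u k)" for n k
    by (simp add: u_def funpow_add)
  have V_add: "V (n + k) = (T ^^ n) (V k)" for n k
    by (simp add: V_def funpow_add)
  have uV: "(\<lambda>k. u (n + r k) y) \<longlonglongrightarrow> V n y" if "y \<in> Y" for n y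
    unfolding u_add V_def using v that by (rule iter_continuous)
  have shift: "strict_mono (\<lambda>k. n + r k)" for n
    using r by (simp add: strict_mono_def)
  \<comment> \<open>The largest one-step decrease of the iterates; it cannot grow under
    \<open>T\<close>, so it converges.\<close>
  define gap where "gap n = Max ((\<lambda>y. u n y - u (Suc n) y) ` Y)" for n
  have gap_ge: "u n y - u (Suc n) y \<le> gap n" if "y \<in> Y" for n y
    unfolding gap_def using that finite_space by (intro Max_ge) auto
  have "gap (Suc n) \<le> gap n" for n
  proof -
    have "u (Suc n) y - u (Suc (Suc n)) y \<le> gap n" if "y \<in> Y" for y
      using iter_le_add[of "u n" "gap n" "u (Suc n)" y 1] gap_ge that
      by (simp add: u_def diff_le_eq)
    then show ?thesis unfolding gap_def[of "Suc n"] using finite_space x by (subst Max_le_iff) auto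
  qed
  then have decseq_gap: "decseq gap" by (rule decseq_SucI)
  have gap_bound: "- (2 * B) \<le> gap n" for n
    using gap_ge[OF x, of n] u_bound[OF x, of n] u_bound[OF x, of "Suc n"] by linarith
  obtain c where c: "gap \<longlonglongrightarrow> c"
    using decseq_convergent[OF decseq_gap, of "- (2 * B)"] gap_bound by metis
  \<comment> \<open>\<open>V n\<close> is the limit of \<open>u (n + r k)\<close> in
    \<open>k\<close>, and along these indices \<open>gap\<close> tends to the same \<open>c\<close>
    for every \<open>n\<close>.\<close>
  have V_gap: "Max ((\<lambda>y. V n y - V (Suc n) y) ` Y) = c" for n
  proof (rule LIMSEQ_unique)
    show "(\<lambda>k. gap (n + r k)) \<longlonglongrightarrow> c"
      using LIMSEQ_subseq_LIMSEQ[OF c shift] by (simp add: o_def)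
    show "(\<lambda>k. gap (n + r k)) \<longlonglongrightarrow> Max ((\<lambda>y. V n y - V (Suc n) y) ` Y)"
      unfolding gap_def using x uV[of _ n] uV[of _ "Suc n"]
      by (intro tendsto_Max_image finite_space tendsto_diff) auto
  qed
  have V_le: "V n y - V (Suc n) y \<le> c" if "y \<in> Y" for n y
    unfolding V_gap[of n, symmetric] using that finite_space by (intro Max_ge) auto
  have "c \<le> 0"
  proof (rule ccontr)
    assume "\<not> c \<le> 0"
    define A where "A n = {y \<in> Y. V n y - V (Suc n) y = c}" for n
    have A_nonempty: "\<exists>y. y \<in> A n" for n
    proof -
      have "c \<in> (\<lambda>y. V n y - V (Suc n) y) ` Y"
        unfolding V_gap[of n, symmetric] using finite_space x by (intro Max_in) auto
      then show ?thesis by (auto simp: A_def)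
    qed
    \<comment> \<open>For a generator optimal for \<open>V n\<close> at \<open>y\<close>, the mean
      decrease is at least \<open>c\<close>, while the decrease is nowhere more than
      \<open>c\<close>; so it equals \<open>c\<close> on the whole support.\<close>
    have A_step: "\<exists>p\<in>P y. set_pmf p \<subseteq> A n \<and> V (Suc n) y = mean p (V n)"
      if y: "y \<in> A (Suc n)" for n y
    proof -
      have yY: "y \<in> Y" using y by (simp add: A_def)
      obtain p where p: "p \<in> P y" "V (Suc n) y = mean p (V n)"
        using T_attained[OF yY, of "V n"] by (auto simp: V_def)
      note supp = P_space[OF yY p(1)] finite_support[OF yY p(1)]
      have "mean p (V (Suc n)) \<le> V (Suc (Suc n)) y"
        using mean_le_T[OF yY p(1)] by (simp add: V_def)
      then have c_le: "c \<le> mean p (\<lambda>z. V n z - V (Suc n) z)"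
        using y p by (simp add: A_def mean_diff)
      have "V n z - V (Suc n) z = c" if z: "z \<in> set_pmf p" for z
      proof (rule ccontr)
        assume "V n z - V (Suc n) z \<noteq> c"
        then have "mean p (\<lambda>z. V n z - V (Suc n) z) < c"
          using V_le[of _ n] supp z
          by (intro mean_less_const[of p _ c z]) (auto simp: order_less_le subset_iff)
        then show False using c_le by simp
      qed
      then show ?thesis using p supp by (auto simp: A_def)
    qed
    have "A n \<subseteq> staying n" for n
    proof (induction n)
      case 0
      have "y \<notin> absorbing" if y: "y \<in> A 0" for y
      proof
        assume abs: "y \<in> absorbing"
        have yY: "y \<in> Y" using y by (simp add: A_def)
        obtain l where l: "(\<lambda>n. u n y) \<longlonglongrightarrow> l"
          using absorbed[OF abs] by (auto simp: convergent_def u_def)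
        \<comment> \<open>Where the iterates of \<open>f\<close> converge, \<open>V\<close> is
          constant in \<open>n\<close>, so its decrease is 0 and not \<open>c\<close>.\<close>
        have "V n y = l" for n
          using LIMSEQ_unique[OF uV[OF yY] LIMSEQ_subseq_LIMSEQ[OF l shift, unfolded o_def]] .
        then show False using y \<open>\<not> c \<le> 0\<close> by (auto simp: A_def)
      qed
      then show ?case by (auto simp: A_def)
    next
      case (Suc n)
      show ?case
      proof
        fix y assume y: "y \<in> A (Suc n)"
        then obtain p where "p \<in> P y" "set_pmf p \<subseteq> A n" using A_step by blast
        then show "y \<in> staying (Suc n)" using Suc y by (auto simp: A_def)
      qed
    qed
    moreover obtain N where "\<And>n. n \<ge> N \<Longrightarrow> staying n = ?Z" using staying_eventually by blast
    ultimately have A_Z: "A (n + N) \<subseteq> ?Z" for n by (metis le_add2)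
    \<comment> \<open>\<open>S\<close> maximises over fewer generators than \<open>T\<close>, which
      gives this bound on all of \<open>?Z\<close>. The reverse bound is shown on
      \<open>A (n + N)\<close>, where an optimal generator is known to be inner.\<close>
    have Z_le: "(S ^^ n) (V N) y \<le> V (n + N) y" if "y \<in> ?Z" for n y
      using that
    proof (induction n arbitrary: y)
      case (Suc n)
      obtain p where p: "p \<in> inner_P y" "S ((S ^^ n) (V N)) y = mean p ((S ^^ n) (V N))"
        using Z.T_attained[OF Suc.prems] unfolding S_def by blast
      then have "\<dots> \<le> mean p (V (n + N))"
        using Suc.IH by (intro mean_mono) (auto simp: inner_P_def)
      also have "\<dots> \<le> T (V (n + N)) y"
        using p Suc.prems non_absorbed_subset by (intro mean_le_T) (auto simp: inner_P_def)
      finally show ?case using p by (simp add: V_def)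
    qed simp
    have Z_ge: "V (n + N) y \<le> (S ^^ n) (V N) y" if "y \<in> A (n + N)" for n y
      using that
    proof (induction n arbitrary: y)
      case (Suc n)
      have yZ: "y \<in> ?Z" using Suc.prems A_Z[of "Suc n"] by blast
      obtain p where p: "p \<in> P y" "set_pmf p \<subseteq> A (n + N)" "V (Suc n + N) y = mean p (V (n + N))"
        using A_step[of y "n + N"] Suc.prems by auto
      have "mean p (V (n + N)) \<le> mean p ((S ^^ n) (V N))"
        using p Suc.IH by (intro mean_mono) auto
      also have "\<dots> \<le> S ((S ^^ n) (V N)) y"
        using p A_Z[of n] yZ unfolding S_def by (intro Z.mean_le_T) (auto simp: inner_P_def)
      finally show ?case using p by simp
    qed simp
    have "\<forall>y\<in>?Z. \<exists>l. (\<lambda>n. (S ^^ n) (V N) y) \<longlonglongrightarrow> l"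
      using restricted by (simp add: convergent_operator_def convergent_def S_def)
    then obtain L where L: "\<And>y. y \<in> ?Z \<Longrightarrow> (\<lambda>n. (S ^^ n) (V N) y) \<longlonglongrightarrow> L y" by metis
    have "(\<lambda>n. (S ^^ n) (V N) y - (S ^^ Suc n) (V N) y) \<longlonglongrightarrow> L y - L y" if "y \<in> ?Z" for y
      using L[OF that] LIMSEQ_Suc[OF L[OF that]] by (rule tendsto_diff)
    then have "\<forall>y\<in>?Z. \<forall>\<^sub>F n in sequentially. (S ^^ n) (V N) y - (S ^^ Suc n) (V N) y < c"
      using \<open>\<not> c \<le> 0\<close> by (auto intro!: order_tendstoD(2) simp del: funpow.simps)
    then have "\<forall>\<^sub>F n in sequentially. \<forall>y\<in>?Z. (S ^^ n) (V N) y - (S ^^ Suc n) (V N) y < c"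
      using Z.finite_space by (rule eventually_ball_finite[rotated])
    then obtain n where n: "\<And>y. y \<in> ?Z \<Longrightarrow> (S ^^ n) (V N) y - (S ^^ Suc n) (V N) y < c"
      unfolding eventually_sequentially by blast
    \<comment> \<open>At \<open>y\<close> the iterate of \<open>S\<close> is at least
      \<open>V (n + N) y\<close> and the next one is at most \<open>V (Suc n + N) y\<close>, so
      \<open>S\<close> also drops by at least \<open>c\<close>.\<close>
    obtain y where y: "y \<in> A (n + N)" using A_nonempty by blast
    then have yZ: "y \<in> ?Z" using A_Z by blast
    have "V (n + N) y - V (Suc n + N) y = c" using y by (simp add: A_def)
    then show False using n[OF yZ] Z_ge[OF y] Z_le[OF yZ, of "Suc n"] by linarith
  qed
  then have "V n x \<le> V (Suc n) x" for n using V_le[OF x, of n] by simp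
  then have incseq_V: "incseq (\<lambda>n. V n x)" by (rule incseq_SucI)
  have V_bound: "V n x \<le> (\<Sum>y\<in>Y. \<bar>v y\<bar>)" for n
    unfolding V_def using iter_bounded[OF x, of n v] by simp
  have "convergent (\<lambda>n. V n x)"
    using incseq_convergent[OF incseq_V, of "\<Sum>y\<in>Y. \<bar>v y\<bar>"] V_bound convergentI by metis
  then have V_Cauchy: "Cauchy (\<lambda>n. V n x)" by (rule convergent_Cauchy)
  have "Cauchy (\<lambda>n. u n x)"
  proof (rule metric_CauchyI)
    fix e :: real assume "e > 0"
    have "\<forall>y\<in>Y. \<forall>\<^sub>F k in sequentially. dist (u (r k) y) (v y) < e / 3"
      using \<open>e > 0\<close> by (intro ballI tendstoD[OF v]) simp_all
    then have "\<forall>\<^sub>F k in sequentially. \<forall>y\<in>Y. dist (u (r k) y) (v y) < e / 3"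
      using finite_space by (rule eventually_ball_finite[rotated])
    then obtain k where k: "\<And>y. y \<in> Y \<Longrightarrow> \<bar>u (r k) y - v y\<bar> < e / 3"
      unfolding eventually_sequentially dist_real_def by blast
    \<comment> \<open>Nonexpansiveness carries the closeness at time \<open>r k\<close> to all later
      times, so a tail of \<open>u\<close> follows the Cauchy sequence \<open>V\<close>.\<close>
    have close: "\<bar>u (n + r k) x - V n x\<bar> \<le> e / 3" for n
      unfolding u_add V_def using k x by (intro iter_nonexpansive less_imp_le)
    obtain N where N: "\<And>m n. m \<ge> N \<Longrightarrow> n \<ge> N \<Longrightarrow> \<bar>V m x - V n x\<bar> < e / 3"
      using metric_CauchyD[OF V_Cauchy, of "e / 3"] \<open>e > 0\<close> unfolding dist_real_def by auto
    have "dist (u m x) (u n x) < e" if "m \<ge> N + r k" "n \<ge> N + r k" for m n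
    proof -
      have "\<bar>u m x - V (m - r k) x\<bar> \<le> e / 3" "\<bar>u n x - V (n - r k) x\<bar> \<le> e / 3"
        using close[of "m - r k"] close[of "n - r k"] that by simp_all
      moreover have "\<bar>V (m - r k) x - V (n - r k) x\<bar> < e / 3"
        using that by (intro N) simp_all
      ultimately show ?thesis unfolding dist_real_def by linarith
    qed
    then show "\<exists>M. \<forall>m\<ge>M. \<forall>n\<ge>M. dist (u m x) (u n x) < e" by blast
  qed
  then show "convergent (\<lambda>n. (T ^^ n) f x)" by (simp add: Cauchy_convergent u_def)
qed

text \<open>Convergence on an empty \<open>non_absorbed Y T\<close> is vacuous, so this form
  includes that case.\<close>

lemma convergent_operator_iff:
  "convergent_operator Y T \<longleftrightarrow>
    (\<forall>C\<in>maximal_classes Y T. regular_class Y T C) \<and>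
    convergent_operator (non_absorbed Y T) (restricted_operator Y T (non_absorbed Y T))"
    (is "_ \<longleftrightarrow> ?regular \<and> ?restricted")
proof
  assume conv: "convergent_operator Y T"
  then show "?regular \<and> ?restricted"
    using convergent_imp_regular[OF conv] convergent_restricted[OF conv] by simp
next
  assume *: "?regular \<and> ?restricted"
  have "convergent (\<lambda>n. (T ^^ n) f x)" if "x \<in> absorbing" for x f
    using that * regular_imp_convergent by (elim UnionE) simp
  then show "convergent_operator Y T"
    using * by (intro convergent_from_restricted) auto
qed

lemma non_absorbed_psubset:
  assumes "Y \<noteq> {}"
  shows "non_absorbed Y T \<subset> Y"
  using maximal_class_exists[OF assms] maximal_class(1,2) by (fastforce simp: non_absorbed_def)

end

section \<open>Induction along the repeated decomposition\<close>

lemma stage_0: "stage_space X T 0 = X" "stage_operator X T 0 = T"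
  by (simp_all add: stage_space_def stage_operator_def)

lemma stage_Suc:
  "stage_space X T (Suc l) = non_absorbed (stage_space X T l) (stage_operator X T l)"
  "stage_operator X T (Suc l) =
    restricted_operator (stage_space X T l) (stage_operator X T l) (stage_space X T (Suc l))"
  by (simp_all add: stage_space_def stage_operator_def case_prod_beta Let_def)

text \<open>Every stage is again finitely generated, so \<open>convergent_operator_iff\<close>
  applies to each. Chaining it down to the depth, where the space is empty, leaves only the
  regularity conditions.\<close>

theorem theorem28:
  fixes X :: "'a set" and T :: "('a \<Rightarrow> real) \<Rightarrow> 'a \<Rightarrow> real"
  assumes "finite X" and "X \<noteq> {}"
    and "upper_transition_operator X T"
    and "finitely_generated X T"
  shows "(convergent_operator X T \<longleftrightarrow>
           (\<forall>C\<in>maximal_classes X T. regular_class X T C) \<and>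
           (non_absorbed X T \<noteq> {} \<longrightarrow>
              convergent_operator (non_absorbed X T) (restricted_operator X T (non_absorbed X T))))
       \<and> (convergent_operator X T \<longleftrightarrow>
           (\<forall>l\<in>{1..decomposition_depth X T}.
              \<forall>C\<in>maximal_classes (stage_space X T (l - 1)) (stage_operator X T (l - 1)).
                regular_class (stage_space X T (l - 1)) (stage_operator X T (l - 1)) C))"
proof
  let ?Y = "stage_space X T" and ?S = "stage_operator X T"
  let ?regular = "\<lambda>l. \<forall>C\<in>maximal_classes (?Y l) (?S l). regular_class (?Y l) (?S l) C"
  have gen: "\<exists>P. generated_operator (?Y l) (?S l) P" for l
  proof (induction l)
    case 0
    then show ?case using assms finitely_generated_iff by (auto simp: stage_0)
  next
    case (Suc l)
    then show ?case
      using generated_operator.generated_restricted unfolding stage_Suc by blast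
  qed
  have conv_empty: "convergent_operator {} S" for S :: "('a \<Rightarrow> real) \<Rightarrow> 'a \<Rightarrow> real"
    by (simp add: convergent_operator_def)
  have step: "convergent_operator (?Y l) (?S l) \<longleftrightarrow>
      ?regular l \<and> convergent_operator (?Y (Suc l)) (?S (Suc l))" for l
    using gen[of l] generated_operator.convergent_operator_iff unfolding stage_Suc by blast
  from step[of 0] show "convergent_operator X T \<longleftrightarrow>
      (\<forall>C\<in>maximal_classes X T. regular_class X T C) \<and>
      (non_absorbed X T \<noteq> {} \<longrightarrow>
        convergent_operator (non_absorbed X T) (restricted_operator X T (non_absorbed X T)))"
    by (auto simp: stage_0 stage_Suc conv_empty)
  have stages: "convergent_operator X T \<longleftrightarrow>
      (\<forall>l<k. ?regular l) \<and> convergent_operator (?Y k) (?S k)" for k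
  proof (induction k)
    case 0
    then show ?case by (simp add: stage_0)
  next
    case (Suc k)
    then show ?case using step[of k] by (auto simp: less_Suc_eq)
  qed
  \<comment> \<open>A nonempty stage contains a maximal class and so loses a state. Hence stage
    \<open>Suc (card X)\<close> is empty, and the least index defining the depth is
    attained.\<close>
  have "card (?Y l) + l \<le> card X \<or> ?Y l = {}" for l
  proof (induction l)
    case (Suc l)
    obtain P where "generated_operator (?Y l) (?S l) P" using gen by blast
    then interpret generated_operator "?Y l" "?S l" P .
    show ?case
    proof (cases "?Y l = {}")
      case True
      then show ?thesis using non_absorbed_subset by (simp add: stage_Suc)
    next
      case False
      then show ?thesis
        using psubset_card_mono[OF finite_space non_absorbed_psubset] Suc by (simp add: stage_Suc)
    qed
  qed (simp add: stage_0)
  from this[of "Suc (card X)"] have "?Y (Suc (card X)) = {}" by simp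
  then have "decomposition_depth X T \<ge> 1 \<and> ?Y (decomposition_depth X T) = {}"
    unfolding decomposition_depth_def
    using LeastI[where P = "\<lambda>l. l \<ge> 1 \<and> ?Y l = {}" and k = "Suc (card X)"] by simp
  then have "convergent_operator X T \<longleftrightarrow> (\<forall>l<decomposition_depth X T. ?regular l)"
    using stages[of "decomposition_depth X T"] conv_empty by simp
  also have "\<dots> \<longleftrightarrow> (\<forall>l\<in>{1..decomposition_depth X T}. ?regular (l - 1))"
    unfolding image_Suc_lessThan[symmetric] by auto
  finally show "convergent_operator X T \<longleftrightarrow>
      (\<forall>l\<in>{1..decomposition_depth X T}. ?regular (l - 1))" .
qed

end
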